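(* Let $\Sigma$ be a finite non-empty alphabet, $\upsilon\notin\Sigma$ a variable, $\xi$ a countable ordinal, and let $\chi_1 : W^{\xi}(\Sigma)\to \{1,\ldots,r_1\}$ and $\chi_2 : W^{\xi}(\Sigma ; \upsilon) \to \{1,\ldots,r_2\}$ be finite colorings ($r_1,r_2\in\mathbb N$). Let $\vec{w} \in W^\omega (\Sigma ; \upsilon)$ be an infinite sequence of variable words over $\Sigma$. Then there exists a variable reduction $\vec{u} \prec \vec{w}$ of $\vec{w}$ such that $\chi_1$ is constant on $W^{\xi}(\Sigma)\cap RW^{<\omega}(\vec u)$ (all the finite reductions of $\vec u$ that lie in $W^{\xi}(\Sigma)$) and $\chi_2$ is constant on $W^{\xi}(\Sigma;\upsilon)\cap VRW^{<\omega}(\vec u)$ (all the finite variable reductions of $\vec u$ that lie in $W^{\xi}(\Sigma;\upsilon)$).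
   Context: $\mathbb N=\{1,2,\ldots\}$. Words. $\Sigma$ is a finite non-empty alphabet and $\upsilon\notin\Sigma$ is the variable. $W(\Sigma)$ is the set of words over $\Sigma$, i.e. non-empty finite sequences of elements of $\Sigma$; $\ast$ is concatenation. $W(\Sigma;\upsilon)=W(\Sigma\cup\{\upsilon\})\setminus W(\Sigma)$ is the set of variable words (words over $\Sigma\cup\{\upsilon\}$ in which $\upsilon$ occurs). For $w\in W(\Sigma;\upsilon)$ and $\alpha\in\Sigma\cup\{\upsilon\}$, $w(\alpha)$ is $w$ with every occurrence of $\upsilon$ replaced by $\alpha$. $W^{<\omega}(\Sigma)$, $W^{<\omega}(\Sigma;\upsilon)$ are the sets of finite sequences (including $\emptyset$) of words, respectively of variable words; $W^{\omega}(\Sigma)$, $W^{\omega}(\Sigma;\upsilon)$ are the corresponding sets of infinite sequences. For a non-empty finite sequence $\mathbf w=(w_1,\ldots,w_l)$ of words over $\Sigma\cup\{\upsilon\}$ write $w_i=\alpha_{k_i}\alpha_{k_i+1}\cdots\alpha_{k_{i+1}-1}$ with $1=k_1<\cdots<k_{l+1}$ (so $k_{i+1}-k_i$ is the length of $w_i$) and put $d(\mathbf w)=\{k_2<\cdots<k_l\}$, with $d(\mathbf w)=\emptyset$ if $l=1$. Reductions. Let $\vec w=(w_n)_{n\in\mathbb N}\in W^{\omega}(\Sigma;\upsilon)$ and let $\mathbf t$ be a finite or infinite sequence of words $t_i=\alpha_{k_i}\cdots\alpha_{k_{i+1}-1}$ over $\Sigma\cup\{\upsilon\}$ ($1=k_1<k_2<\cdots$).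 Then $\vec w[\mathbf t]$ is the sequence with $i$-th term $w_{k_i}(\alpha_{k_i})\ast\cdots\ast w_{k_{i+1}-1}(\alpha_{k_{i+1}-1})$; $\vec w[\emptyset]=\emptyset$. Put $RW^{<\omega}(\vec w)=\{\vec w[\mathbf t]:\mathbf t\in W^{<\omega}(\Sigma)\}$ (finite reductions) and $VRW^{<\omega}(\vec w)=\{\vec w[\mathbf t]:\mathbf t\in W^{<\omega}(\Sigma;\upsilon)\}$ (finite variable reductions). $\vec u\prec\vec w$ ($\vec u$ is a variable reduction of $\vec w$) means $\vec u=\vec w[\vec t]$ for some $\vec t\in W^{\omega}(\Sigma;\upsilon)$. Schreier system. For every non-zero countable limit ordinal $\lambda$ fix a strictly increasing sequence $(\lambda_n)_{n\in\mathbb N}$ of successor ordinals smaller than $\lambda$ with $\sup_n\lambda_n=\lambda$. For sets $s,t$ of natural numbers $s<t$ means every element of $s$ is smaller than every element of $t$. Families $\mathcal A_\xi$ ($\xi<\omega_1$) of finite subsets of $\mathbb N$ are defined recursively: (1) $\mathcal A_0=\{\emptyset\}$, $\mathcal A_1=\{\{n\}:n\in\mathbb N\}$; (2) $\mathcal A_{\zeta+1}=\{\{n\}\cup s_1: n\in\mathbb N,\ \{n\}<s_1,\ s_1\in\mathcal A_\zeta\}$; (3i) $\mathcal A_{\omega^{\beta+1}}=\{\bigcup_{i=1}^n s_i: n=\min s_1,\ s_1<\cdots<s_n,\ s_1,\ldots,s_n\in\mathcal A_{\omega^\beta}\}$; (3ii) for a non-zero countable limit ordinal $\lambda$, $\mathcal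 A_{\omega^\lambda}=\{s\neq\emptyset: s\in\mathcal A_{\omega^{\lambda_n}}\text{ with }n=\min s\}$; (3iii) for a limit ordinal $\xi$ with $\omega^{\alpha}<\xi<\omega^{\alpha+1}$, $0<\alpha<\omega_1$, with Cantor normal form $\xi=\omega^\alpha p+\sum_{i=1}^m\omega^{a_i}p_i$ ($m\ge0$, $p,p_1,\ldots,p_m\geq1$ natural numbers, $\alpha>a_1>\cdots>a_m>0$), $\mathcal A_\xi$ is the set of all $s=s_0\cup\bigcup_{i=1}^m s_i$ with $s_m<\cdots<s_1<s_0$, where $s_0$ is a union of $p$ sets $s^0_1<\cdots<s^0_p$ from $\mathcal A_{\omega^\alpha}$ and each $s_i$ is a union of $p_i$ sets $s^i_1<\cdots<s^i_{p_i}$ from $\mathcal A_{\omega^{a_i}}$. Schreier sequences of words. $W^0(\Sigma)$, $W^0(\Sigma;\upsilon)$ are the sets of one-term sequences $(w_1)$ with $w_1\in W(\Sigma)$, resp. $w_1\in W(\Sigma;\upsilon)$. For a countable ordinal $\xi\ge1$, $W^\xi(\Sigma)$ (resp. $W^\xi(\Sigma;\upsilon)$) is the set of non-empty $\mathbf w$ in $W^{<\omega}(\Sigma)$ (resp. $W^{<\omega}(\Sigma;\upsilon)$) with $d(\mathbf w)\in\mathcal A_\xi$. *)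

theory Defs
  imports "HOL-Library.Countable_Set_Type" "HOL-Library.FuncSet"
begin

section \<open>Countable ordinals\<close>

text \<open>The successor cardinal of \<^term>\<open>natLeq\<close> is a well-order of type \<open>\<omega>\<^sub>1\<close>, so the elements of its
  field are, up to order isomorphism, the countable ordinals.\<close>

typedef omega1 = "Field (cardSuc natLeq)"
  using Field_cardSuc_not_empty[OF natLeq_Card_order] by blast

instantiation omega1 :: wellorder
begin

definition "x \<le> y \<longleftrightarrow> (Rep_omega1 x, Rep_omega1 y) \<in> cardSuc natLeq"
definition "x < y \<longleftrightarrow> x \<le> y \<and> x \<noteq> (y :: omega1)"

instance
proof -
  have wo: "Well_order (cardSuc natLeq)"
    by (rule cardSuc_Well_order[OF natLeq_Card_order])
  have "refl_on (Field (cardSuc natLeq)) (cardSuc natLeq)" and t: "trans (cardSuc natLeq)"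
    and a: "antisym (cardSuc natLeq)" and tot: "total_on (Field (cardSuc natLeq)) (cardSuc natLeq)"
    and wf: "wf (cardSuc natLeq - Id)"
    using wo by (auto simp: well_order_on_def linear_order_on_def partial_order_on_def preorder_on_def)
  then have r: "(Rep_omega1 x, Rep_omega1 x) \<in> cardSuc natLeq" for x
    using Rep_omega1 by (auto simp: refl_on_def)
  have eq: "Rep_omega1 x = Rep_omega1 y \<Longrightarrow> x = y" for x y by (simp add: Rep_omega1_inject)
  have 1: "x \<le> x" for x :: omega1 using r by (simp add: less_eq_omega1_def)
  have 2: "x \<le> y \<Longrightarrow> y \<le> z \<Longrightarrow> x \<le> z" for x y z :: omega1
    using t by (auto simp: less_eq_omega1_def trans_def)
  have 3: "x \<le> y \<Longrightarrow> y \<le> x \<Longrightarrow> x = y" for x y :: omega1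
    using a by (auto simp: less_eq_omega1_def antisym_def intro: eq)
  have 4: "x \<le> y \<or> y \<le> x" for x y :: omega1
    using tot 1[of x] Rep_omega1[of x] Rep_omega1[of y]
    unfolding less_eq_omega1_def total_on_def by (metis eq)
  have 5: "P x" if step: "\<And>x. (\<And>y. y < x \<Longrightarrow> P y) \<Longrightarrow> P x" for P and x :: omega1
  proof -
    have "wf (inv_image (cardSuc natLeq - Id) Rep_omega1)" using wf by (rule wf_inv_image)
    then show ?thesis
    proof (induction x rule: wf_induct_rule)
      case (less x)
      show ?case
        by (rule step, rule less) (auto simp: less_omega1_def less_eq_omega1_def inv_image_def Rep_omega1_inject)
    qed
  qed
  show "OFCLASS(omega1, wellorder_class)"
  proof intro_classes
    fix x y z :: omega1 and P
    show "x < y \<longleftrightarrow> x \<le> y \<and> \<not> y \<le> x" using 1 3 by (auto simp: less_omega1_def)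
    show "x \<le> x" by (rule 1)
    show "x \<le> y \<Longrightarrow> y \<le> z \<Longrightarrow> x \<le> z" by (rule 2)
    show "x \<le> y \<Longrightarrow> y \<le> x \<Longrightarrow> x = y" by (rule 3)
    show "x \<le> y \<or> y \<le> x" by (rule 4)
    show "(\<And>x. (\<And>y. y < x \<Longrightarrow> P y) \<Longrightarrow> P x) \<Longrightarrow> P x" using 5 by blast
  qed
qed

end

instantiation omega1 :: conditionally_complete_linorder
begin

definition "inf = (min :: omega1 \<Rightarrow> _)"
definition "sup = (max :: omega1 \<Rightarrow> _)"
definition "Inf X = (LEAST x :: omega1. x \<in> X)"
definition "Sup X = (LEAST x :: omega1. \<forall>y\<in>X. y \<le> x)"

instance
proof
  fix x z :: omega1 and X
  show "x \<in> X \<Longrightarrow> Inf X \<le> x" by (simp add: Inf_omega1_def Least_le)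
  show "X \<noteq> {} \<Longrightarrow> (\<And>x. x \<in> X \<Longrightarrow> z \<le> x) \<Longrightarrow> z \<le> Inf X"
    by (metis Inf_omega1_def LeastI ex_in_conv)
  show "x \<in> X \<Longrightarrow> bdd_above X \<Longrightarrow> x \<le> Sup X"
    unfolding Sup_omega1_def bdd_above_def by (rule LeastI2_ex) auto
  show "X \<noteq> {} \<Longrightarrow> (\<And>x. x \<in> X \<Longrightarrow> x \<le> z) \<Longrightarrow> Sup X \<le> z"
    unfolding Sup_omega1_def by (rule Least_le) auto
qed (auto simp: inf_omega1_def sup_omega1_def)

end

lemma countable_omega1_below:
  includes cardinal_syntax
  shows "countable {..<x :: omega1}"
proof -
  let ?r = "cardSuc natLeq"
  have "|underS ?r (Rep_omega1 x)| <o ?r"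
    by (rule card_of_underS[OF cardSuc_Card_order[OF natLeq_Card_order] Rep_omega1])
  then have "|underS ?r (Rep_omega1 x)| \<le>o natLeq"
    by (simp add: cardSuc_ordLeq_ordLess[OF natLeq_Card_order card_of_Card_order])
  then have "countable (underS ?r (Rep_omega1 x))"
    by (simp add: countable_card_le_natLeq)
  moreover have "Rep_omega1 ` {..<x} \<subseteq> underS ?r (Rep_omega1 x)"
    by (auto simp: underS_def less_omega1_def less_eq_omega1_def Rep_omega1_inject)
  ultimately have "countable (Rep_omega1 ` {..<x})" by (rule countable_subset[rotated])
  then show ?thesis
    by (rule countable_image_inj_on) (simp add: inj_on_def Rep_omega1_inject)
qed

lemma uncountable_omega1:
  includes cardinal_syntax
  shows "uncountable (UNIV :: omega1 set)"
proof
  assume "countable (UNIV :: omega1 set)"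
  then have "countable (range Rep_omega1)" by (rule countable_image)
  then have "|Field (cardSuc natLeq)| \<le>o natLeq"
    by (simp add: countable_card_le_natLeq type_definition.Rep_range[OF type_definition_omega1])
  then have "cardSuc natLeq \<le>o natLeq"
    using card_of_Field_ordIso[OF cardSuc_Card_order[OF natLeq_Card_order]]
      ordIso_ordLeq_trans ordIso_symmetric by blast
  then show False
    using cardSuc_greater[OF natLeq_Card_order] not_ordLess_ordLeq by blast
qed

lemma countable_bdd_omega1:
  assumes "countable X"
  shows "bdd_above (X :: omega1 set)"
proof (rule ccontr)
  assume "\<not> bdd_above X"
  then have "UNIV = (\<Union>x\<in>X. {..<x})"
    by (force simp: bdd_above_def not_le)
  moreover have "countable (\<Union>x\<in>X. {..<x})"
    using assms countable_omega1_below by blast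
  ultimately show False using uncountable_omega1 by simp
qed

instantiation omega1 :: "{zero, one}"
begin

definition "0 = (LEAST x :: omega1. True)"
definition "1 = (LEAST x :: omega1. 0 < x)"

instance ..

end

definition succ :: "omega1 \<Rightarrow> omega1" where
  "succ a = (LEAST b. a < b)"

text \<open>All suprema taken below are over non-empty countable sets, so they exist by
  \<open>countable_bdd_omega1\<close>.  Each recursion treats zero, successor and limit arguments uniformly; the
  customary separate equations are derived afterwards.\<close>

instantiation omega1 :: "{plus, times}"
begin

function plus_omega1 :: "omega1 \<Rightarrow> omega1 \<Rightarrow> omega1" where
  "plus_omega1 a b = Sup (insert a ((\<lambda>c. succ (plus_omega1 a c)) ` {..<b}))"
  by auto
termination
  by (relation "inv_image {(x, y). x < y} snd") (rule wf_inv_image[OF wf], simp)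

declare plus_omega1.simps [simp del]

function times_omega1 :: "omega1 \<Rightarrow> omega1 \<Rightarrow> omega1" where
  "times_omega1 a b = Sup (insert 0 ((\<lambda>c. times_omega1 a c + a) ` {..<b}))"
  by auto
termination
  by (relation "inv_image {(x, y). x < y} snd") (rule wf_inv_image[OF wf], simp)

declare times_omega1.simps [simp del]

instance ..

end

fun ord_of_nat :: "nat \<Rightarrow> omega1" where
  "ord_of_nat 0 = 0"
| "ord_of_nat (Suc n) = succ (ord_of_nat n)"

definition omega :: omega1 where
  "omega = Sup (range ord_of_nat)"

function omega_pow :: "omega1 \<Rightarrow> omega1" where
  "omega_pow b = Sup (insert 1 ((\<lambda>c. omega_pow c * omega) ` {..<b}))"
  by auto
termination
  by (relation "{(x, y). x < y}") (rule wf, simp)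

declare omega_pow.simps [simp del]

definition succ_ord :: "omega1 \<Rightarrow> bool" where
  "succ_ord a \<longleftrightarrow> (\<exists>b. a = b + 1)"

definition limit_ord :: "omega1 \<Rightarrow> bool" where
  "limit_ord a \<longleftrightarrow> a \<noteq> 0 \<and> \<not> succ_ord a"

lemma zero_le_omega1 [simp]: "0 \<le> (a :: omega1)"
  by (simp add: zero_omega1_def Least_le)

lemma not_less_zero_omega1 [simp]: "\<not> a < (0 :: omega1)"
  by (simp add: not_less)

lemma less_succ: "a < succ a"
proof -
  have "\<exists>b. a < b"
  proof (rule ccontr)
    assume "\<not> (\<exists>b. a < b)"
    then have "UNIV = insert a {..<a}" using linorder_neqE by blast
    moreover have "countable (insert a {..<a})"
      by (simp add: countable_omega1_below)
    ultimately show False using uncountable_omega1 by simp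
  qed
  then show ?thesis unfolding succ_def by (rule LeastI_ex)
qed

lemma succ_le_iff: "succ a \<le> b \<longleftrightarrow> a < b"
  using less_succ[of a] by (auto simp: succ_def intro: Least_le)

lemma less_succ_iff: "a < succ b \<longleftrightarrow> a \<le> b"
  by (metis succ_le_iff not_le)

lemma succ_inject [simp]: "succ a = succ b \<longleftrightarrow> a = b"
  by (metis less_succ_iff less_succ order.antisym)

lemma one_eq_succ_zero: "1 = succ 0"
  by (simp add: one_omega1_def succ_def)

lemma countable_Sup_le_iff:
  "countable X \<Longrightarrow> Sup (insert (a :: omega1) X) \<le> z \<longleftrightarrow> a \<le> z \<and> (\<forall>x\<in>X. x \<le> z)"
  by (subst cSup_le_iff) (auto intro: countable_bdd_omega1)

lemma plus_le_iff: "a + b \<le> z \<longleftrightarrow> a \<le> z \<and> (\<forall>c<b. a + c < z)" for a b z :: omega1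
  by (subst plus_omega1.simps)
     (auto simp: countable_Sup_le_iff countable_omega1_below succ_le_iff)

lemma times_le_iff: "a * b \<le> z \<longleftrightarrow> (\<forall>c<b. a * c + a \<le> z)" for a b z :: omega1
  by (subst times_omega1.simps) (auto simp: countable_Sup_le_iff countable_omega1_below)

lemma omega_pow_le_iff: "omega_pow b \<le> z \<longleftrightarrow> 1 \<le> z \<and> (\<forall>c<b. omega_pow c * omega \<le> z)"
  by (subst omega_pow.simps) (auto simp: countable_Sup_le_iff countable_omega1_below)

lemma plus_strict_mono: "b < c \<Longrightarrow> a + b < a + (c :: omega1)"
  using plus_le_iff[of a c "a + c"] by simp

lemma plus_mono: "b \<le> c \<Longrightarrow> a + b \<le> a + (c :: omega1)"
  by (metis plus_strict_mono order.order_iff_strict)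

lemma plus_less_cancel [simp]: "a + b < a + c \<longleftrightarrow> b < (c :: omega1)"
  by (metis plus_mono plus_strict_mono not_less)

lemma plus_cancel [simp]: "a + b = a + c \<longleftrightarrow> b = (c :: omega1)"
  by (metis plus_less_cancel neq_iff)

lemma omega1_plus_zero [simp]: "a + 0 = (a :: omega1)"
proof (rule order.antisym)
  show "a + 0 \<le> a" by (simp add: plus_le_iff)
  show "a \<le> a + 0" using plus_le_iff[of a 0 "a + 0"] by simp
qed

lemma le_plus_omega1: "a \<le> a + (b :: omega1)"
  using plus_le_iff[of a b "a + b"] by simp

lemma omega1_zero_plus [simp]: "0 + a = (a :: omega1)"
proof (induction a rule: less_induct)
  case (less a)
  show ?case
  proof (rule order.antisym)
    show "0 + a \<le> a" using less by (simp add: plus_le_iff)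
    show "a \<le> 0 + a"
    proof (rule ccontr)
      assume "\<not> a \<le> 0 + a"
      then have "0 + a < a" by simp
      then show False using less[of "0 + a"] plus_strict_mono[of "0 + a" a 0] by simp
    qed
  qed
qed

lemma omega1_plus_succ: "a + succ b = succ (a + b)"
proof (rule order.antisym)
  show "a + succ b \<le> succ (a + b)"
    unfolding plus_le_iff[of a "succ b"] less_succ_iff
    using le_plus_omega1[of a b] less_succ[of "a + b"] by (auto intro: plus_mono)
  show "succ (a + b) \<le> a + succ b" by (simp add: succ_le_iff less_succ)
qed

lemma omega1_plus_one [simp]: "a + 1 = succ a"
  by (simp add: one_eq_succ_zero omega1_plus_succ)

lemma limit_ord_iff: "limit_ord a \<longleftrightarrow> a \<noteq> 0 \<and> (\<forall>b<a. succ b < a)"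
proof -
  have "a = succ b \<longleftrightarrow> b < a \<and> \<not> succ b < a" for b
    using less_succ[of b] succ_le_iff[of b a] by auto
  then show ?thesis by (auto simp: limit_ord_def succ_ord_def)
qed

lemma omega1_cases [case_names zero succ limit]:
  obtains "a = 0" | b where "a = succ b" | "limit_ord a"
  by (auto simp: limit_ord_def succ_ord_def)

lemma bdd_above_image_below: "bdd_above (f ` {..<b :: omega1} :: omega1 set)"
  by (simp add: countable_bdd_omega1 countable_omega1_below)

lemma omega1_plus_limit:
  assumes "limit_ord b"
  shows "a + b = (SUP c\<in>{..<b}. a + c)"
proof (rule order.antisym)
  have b: "0 < b" using assms by (simp add: limit_ord_def order.strict_iff_order)
  have up: "a + c \<le> (SUP c\<in>{..<b}. a + c)" if "c < b" for c
    using that bdd_above_image_below by (auto intro: cSUP_upper)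
  have "a + c < (SUP c\<in>{..<b}. a + c)" if "c < b" for c
    using up[of "succ c"] assms that by (simp add: limit_ord_iff omega1_plus_succ succ_le_iff)
  then show "a + b \<le> (SUP c\<in>{..<b}. a + c)"
    unfolding plus_le_iff[of a b] using up[OF b] by simp
  show "(SUP c\<in>{..<b}. a + c) \<le> a + b"
    using b by (auto intro!: cSUP_least plus_mono)
qed

instance omega1 :: monoid_add
proof
  fix a b c :: omega1
  show "a + b + c = a + (b + c)"
  proof (induction c rule: less_induct)
    case (less c)
    show ?case
    proof (rule order.antisym)
      show "a + b + c \<le> a + (b + c)"
        unfolding plus_le_iff[of "a + b" c] using less by (simp add: plus_mono le_plus_omega1)
      have "a + d < a + b + c" if "d < b + c" for d
      proof (cases "d < b")
        case True
        then have "a + d < a + b" by simp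
        also have "\<dots> \<le> a + b + c" by (rule le_plus_omega1)
        finally show ?thesis .
      next
        case False
        have "\<exists>e<c. d \<le> b + e"
          using that False plus_le_iff[of b c d] by (auto simp flip: not_le)
        then obtain e where e: "e < c" "d \<le> b + e" by blast
        have "a + d \<le> a + (b + e)" using e(2) by (rule plus_mono)
        also have "\<dots> = a + b + e" using less[OF e(1)] by simp
        also have "\<dots> < a + b + c" using e by simp
        finally show ?thesis .
      qed
      moreover have "a \<le> a + b + c"
        using le_plus_omega1[of a b] le_plus_omega1[of "a + b" c] by (rule order.trans)
      ultimately show "a + (b + c) \<le> a + b + c"
        unfolding plus_le_iff[of a "b + c"] by blast
    qed
  qed
qed auto

lemma omega1_times_zero [simp]: "a * 0 = (0 :: omega1)"
  using times_le_iff[of a 0 0] by (simp add: order.antisym)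

lemma times_mono: "b \<le> c \<Longrightarrow> a * b \<le> a * (c :: omega1)"
  unfolding times_le_iff[of a b] using times_le_iff[of a c "a * c"] by auto

lemma plus_right_mono: "a \<le> b \<Longrightarrow> a + c \<le> b + (c :: omega1)"
proof (induction c rule: less_induct)
  case (less c)
  have "a \<le> b + c" using less.prems le_plus_omega1[of b c] by (rule order.trans)
  moreover have "a + d < b + c" if "d < c" for d
    using less.IH[OF that less.prems] plus_strict_mono[OF that, of b] by (rule order.strict_trans1)
  ultimately show ?case
    unfolding plus_le_iff[of a c] by blast
qed

lemma omega1_times_succ: "a * succ b = a * b + a"
proof (rule order.antisym)
  show "a * succ b \<le> a * b + a"
    unfolding times_le_iff[of a "succ b"] by (simp add: less_succ_iff plus_right_mono times_mono)
  show "a * b + a \<le> a * succ b"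
    using times_le_iff[of a "succ b" "a * succ b"] less_succ by blast
qed

lemma omega1_times_limit:
  assumes "limit_ord b"
  shows "a * b = (SUP c\<in>{..<b}. a * c)"
proof (rule order.antisym)
  have b: "0 < b" using assms by (simp add: limit_ord_def order.strict_iff_order)
  have up: "a * c \<le> (SUP c\<in>{..<b}. a * c)" if "c < b" for c
    using that bdd_above_image_below by (auto intro: cSUP_upper)
  show "a * b \<le> (SUP c\<in>{..<b}. a * c)"
    unfolding times_le_iff[of a b] using up assms
    by (simp add: limit_ord_iff flip: omega1_times_succ)
  show "(SUP c\<in>{..<b}. a * c) \<le> a * b"
    using b by (auto intro!: cSUP_least times_mono)
qed

lemma less_omega_iff: "a < omega \<longleftrightarrow> (\<exists>n. a < ord_of_nat n)"
  unfolding omega_def by (subst less_cSup_iff) (auto intro: countable_bdd_omega1)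

lemma ord_of_nat_less_omega: "ord_of_nat n < omega"
  unfolding less_omega_iff by (rule exI[of _ "Suc n"]) (simp add: less_succ)

lemma limit_ord_omega: "limit_ord omega"
  unfolding limit_ord_iff
proof safe
  show "omega = 0 \<Longrightarrow> False" using ord_of_nat_less_omega[of 0] by simp
  fix b assume "b < omega"
  then obtain n where "b < ord_of_nat n" by (auto simp: less_omega_iff)
  then have "succ b \<le> ord_of_nat n" by (simp add: succ_le_iff)
  then show "succ b < omega" using ord_of_nat_less_omega by (rule order.strict_trans1)
qed

lemma one_le_omega_pow: "1 \<le> omega_pow a"
  using omega_pow_le_iff[of a "omega_pow a"] by simp

lemma omega_pow_zero [simp]: "omega_pow 0 = 1"
  using omega_pow_le_iff[of 0 1] one_le_omega_pow[of 0] by (simp add: order.antisym)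

lemma omega_pow_mono: "a \<le> b \<Longrightarrow> omega_pow a \<le> omega_pow b"
  unfolding omega_pow_le_iff[of a] using omega_pow_le_iff[of b "omega_pow b"] by auto

lemma times_right_mono: "a \<le> b \<Longrightarrow> a * c \<le> b * (c :: omega1)"
proof (induction c rule: less_induct)
  case (less c)
  show ?case
    unfolding times_le_iff[of a c]
  proof (intro allI impI)
    fix d assume d: "d < c"
    have "a * d + a \<le> b * d + a" using less d by (intro plus_right_mono) auto
    also have "\<dots> \<le> b * d + b" using less.prems by (rule plus_mono)
    also have "\<dots> \<le> b * c" using d times_le_iff[of b c "b * c"] by blast
    finally show "a * d + a \<le> b * c" .
  qed
qed

lemma less_omega_pow_times_omega: "omega_pow a < omega_pow a * omega"
proof -
  have "0 < omega_pow a"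
    using less_succ[of 0] one_le_omega_pow[of a] unfolding one_eq_succ_zero by (rule order.strict_trans2)
  then have "omega_pow a * 1 < omega_pow a * succ 1"
    using plus_strict_mono[of 0 "omega_pow a" "omega_pow a * 1"] by (simp add: omega1_times_succ)
  also have "\<dots> \<le> omega_pow a * omega"
    using ord_of_nat_less_omega[of 2]
    by (intro times_mono) (simp add: numeral_2_eq_2 one_eq_succ_zero)
  finally show ?thesis by (simp add: one_eq_succ_zero omega1_times_succ)
qed

lemma omega_pow_succ: "omega_pow (succ a) = omega_pow a * omega"
proof (rule order.antisym)
  have "1 \<le> omega_pow a * omega"
    using one_le_omega_pow[of a] less_omega_pow_times_omega[of a] by simp
  then show "omega_pow (succ a) \<le> omega_pow a * omega"
    unfolding omega_pow_le_iff[of "succ a"]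
    by (simp add: less_succ_iff times_right_mono omega_pow_mono)
  show "omega_pow a * omega \<le> omega_pow (succ a)"
    using omega_pow_le_iff[of "succ a" "omega_pow (succ a)"] less_succ by blast
qed

lemma omega_pow_limit:
  assumes "limit_ord b"
  shows "omega_pow b = (SUP c\<in>{..<b}. omega_pow c)"
proof (rule order.antisym)
  have b: "0 < b" using assms by (simp add: limit_ord_def order.strict_iff_order)
  have up: "omega_pow c \<le> (SUP c\<in>{..<b}. omega_pow c)" if "c < b" for c
    using that bdd_above_image_below by (auto intro: cSUP_upper)
  show "omega_pow b \<le> (SUP c\<in>{..<b}. omega_pow c)"
    unfolding omega_pow_le_iff[of b] using up[OF b] up assms
    by (simp add: limit_ord_iff flip: omega_pow_succ)
  show "(SUP c\<in>{..<b}. omega_pow c) \<le> omega_pow b"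
    using b by (auto intro!: cSUP_least omega_pow_mono)
qed

lemma omega_pow_strict_mono: "a < b \<Longrightarrow> omega_pow a < omega_pow b"
  using omega_pow_le_iff[of b "omega_pow b"] less_omega_pow_times_omega[of a]
  by (auto intro: order.strict_trans2)


section \<open>The Schreier system\<close>

definition fundamental_seqs :: "(omega1 \<Rightarrow> nat \<Rightarrow> omega1) \<Rightarrow> bool" where
  "fundamental_seqs L \<longleftrightarrow> (\<forall>l. limit_ord l \<longrightarrow>
     strict_mono_on {1..} (L l) \<and> (\<forall>n\<ge>1. succ_ord (L l n) \<and> L l n < l) \<and> (SUP n\<in>{1..}. L l n) = l)"

definition set_less :: "nat set \<Rightarrow> nat set \<Rightarrow> bool" where
  "set_less s t \<longleftrightarrow> (\<forall>m\<in>s. \<forall>n\<in>t. m < n)"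

text \<open>A Cantor normal form \<open>\<omega>\<^sup>a\<^sup>1 p\<^sub>1 + \<omega>\<^sup>a\<^sup>2 p\<^sub>2 + \<dots>\<close> of a limit ordinal is given by its list of pairs of
  exponents and coefficients; as the ordinal is a limit, no exponent is zero.\<close>

definition limit_cnf :: "(omega1 \<times> nat) list \<Rightarrow> bool" where
  "limit_cnf xs \<longleftrightarrow> sorted_wrt (>) (map fst xs) \<and> (\<forall>(a, p)\<in>set xs. 0 < a \<and> 1 \<le> p)"

definition cnf_value :: "(omega1 \<times> nat) list \<Rightarrow> omega1" where
  "cnf_value xs = sum_list (map (\<lambda>(a, p). omega_pow a * ord_of_nat p) xs)"

text \<open>\<open>schreier L \<xi> s\<close> means \<open>s \<in> \<A>\<^sub>\<xi>\<close>.  The defining recursion on \<open>\<xi>\<close> is rendered inductively: each \<open>\<xi>\<close>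
  is governed by a single clause and the families are used only positively, so the least relation
  closed under the clauses is the recursively defined one.  In the last clause \<open>ss = [s\<^sub>0, \<dots>, s\<^sub>m]\<close>,
  and the pairs in \<open>(\<alpha>, p) # xs\<close> are \<open>(\<alpha>, p), (a\<^sub>1, p\<^sub>1), \<dots>, (a\<^sub>m, p\<^sub>m)\<close>.\<close>

inductive schreier :: "(omega1 \<Rightarrow> nat \<Rightarrow> omega1) \<Rightarrow> omega1 \<Rightarrow> nat set \<Rightarrow> bool" for L where
  zero: "schreier L 0 {}"
| one: "1 \<le> n \<Longrightarrow> schreier L 1 {n}"
| succ: "1 \<le> n \<Longrightarrow> set_less {n} s \<Longrightarrow> schreier L \<zeta> s \<Longrightarrow> schreier L (\<zeta> + 1) ({n} \<union> s)"
| pow_succ: "ss \<noteq> [] \<Longrightarrow> length ss = Min (hd ss) \<Longrightarrow> sorted_wrt set_less ss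
    \<Longrightarrow> (\<forall>s\<in>set ss. schreier L (omega_pow \<beta>) s)
    \<Longrightarrow> schreier L (omega_pow (\<beta> + 1)) (\<Union> (set ss))"
| pow_limit: "limit_ord l \<Longrightarrow> s \<noteq> {} \<Longrightarrow> schreier L (omega_pow (L l (Min s))) s
    \<Longrightarrow> schreier L (omega_pow l) s"
| cnf: "limit_ord \<xi> \<Longrightarrow> 0 < \<alpha> \<Longrightarrow> omega_pow \<alpha> < \<xi> \<Longrightarrow> \<xi> < omega_pow (\<alpha> + 1)
    \<Longrightarrow> limit_cnf ((\<alpha>, p) # xs) \<Longrightarrow> \<xi> = cnf_value ((\<alpha>, p) # xs)
    \<Longrightarrow> length ss = length ((\<alpha>, p) # xs) \<Longrightarrow> sorted_wrt (\<lambda>s t. set_less t s) ss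
    \<Longrightarrow> (\<forall>i<length ss. \<exists>ts. length ts = snd (((\<alpha>, p) # xs) ! i) \<and> sorted_wrt set_less ts \<and>
          (\<forall>t\<in>set ts. schreier L (omega_pow (fst (((\<alpha>, p) # xs) ! i))) t) \<and> ss ! i = \<Union> (set ts))
    \<Longrightarrow> schreier L \<xi> (\<Union> (set ss))"

text \<open>The clauses do not overlap (except that \<open>one\<close> and \<open>succ\<close> agree at 1), and hence hold as equations.\<close>

lemma omega_pow_eq_iff [simp]: "omega_pow a = omega_pow b \<longleftrightarrow> a = b"
  using omega_pow_strict_mono[of a b] omega_pow_strict_mono[of b a]
  by (metis linorder_neqE order.strict_implies_not_eq)

lemma times_add_nat: "a * ord_of_nat m + a * ord_of_nat n = a * ord_of_nat (m + n)"
  by (induction n) (simp_all add: omega1_times_succ flip: add.assoc)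

lemma times_nat_less: "omega_pow b * ord_of_nat n < omega_pow (succ b)"
proof -
  have "0 < omega_pow b"
    using less_succ[of 0] one_le_omega_pow[of b] unfolding one_eq_succ_zero by (rule order.strict_trans2)
  then have "omega_pow b * ord_of_nat n < omega_pow b * succ (ord_of_nat n)"
    using plus_strict_mono[of 0 "omega_pow b"] by (fastforce simp: omega1_times_succ)
  also have "\<dots> \<le> omega_pow b * omega"
    using ord_of_nat_less_omega[of "Suc n"] by (intro times_mono) simp
  finally show ?thesis by (simp add: omega_pow_succ)
qed

lemma less_omega_pow_succE:
  assumes "x < omega_pow (succ b)"
  obtains n where "x < omega_pow b * ord_of_nat n"
proof -
  from assms obtain c where c: "c < omega" "x < omega_pow b * c + omega_pow b"
    using times_le_iff[of "omega_pow b" omega x] by (auto simp: omega_pow_succ simp flip: not_le)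
  then obtain n where "succ c \<le> ord_of_nat n" by (auto simp: less_omega_iff succ_le_iff)
  then have "omega_pow b * succ c \<le> omega_pow b * ord_of_nat n" by (rule times_mono)
  with c(2) that show ?thesis by (auto simp: omega1_times_succ intro: order.strict_trans2)
qed

lemma less_omega_pow_limitE:
  assumes "x < omega_pow b" "limit_ord b"
  obtains c where "c < b" "x < omega_pow c"
proof -
  have "0 < b" using assms(2) by (simp add: limit_ord_def order.strict_iff_order)
  then have "{..<b} \<noteq> {}" by blast
  then have "\<exists>c\<in>{..<b}. x < omega_pow c"
    using assms less_cSUP_iff[OF _ bdd_above_image_below, of b x omega_pow] by (simp add: omega_pow_limit)
  then show ?thesis using that by auto
qed

lemma omega_pow_add_closed:
  assumes "x < omega_pow a" "y < omega_pow a"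
  shows "x + y < omega_pow a"
proof (cases a rule: omega1_cases)
  case zero
  then have "x = 0" "y = 0"
    using assms by (simp_all add: one_eq_succ_zero less_succ_iff order.antisym)
  then show ?thesis using assms by simp
next
  case (succ b)
  obtain m n where mn: "x < omega_pow b * ord_of_nat m" "y < omega_pow b * ord_of_nat n"
    using assms unfolding succ by (blast elim: less_omega_pow_succE)
  have "x + y \<le> omega_pow b * ord_of_nat m + y" using mn by (intro plus_right_mono) simp
  also have "\<dots> < omega_pow b * ord_of_nat m + omega_pow b * ord_of_nat n" using mn by simp
  also have "\<dots> < omega_pow a" unfolding times_add_nat succ by (rule times_nat_less)
  finally show ?thesis .
next
  case limit
  then show ?thesis using assms
  proof (induction a arbitrary: x y rule: less_induct)
    case (less a)
    obtain c d where cd: "c < a" "x < omega_pow c" "d < a" "y < omega_pow d"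
      using less.prems by (blast elim: less_omega_pow_limitE)
    define e where "e = max c d"
    have e: "succ e < a" using cd less.prems by (simp add: e_def limit_ord_iff)
    have "x < omega_pow e" "y < omega_pow e"
      using cd omega_pow_mono[of c e] omega_pow_mono[of d e] by (auto simp: e_def intro: order.strict_trans2)
    then have xy: "x \<le> omega_pow e" "y < omega_pow e" by simp_all
    have "x + y \<le> omega_pow e + y" using xy(1) by (rule plus_right_mono)
    also have "\<dots> < omega_pow e + omega_pow e" using xy by simp
    also have "\<dots> = omega_pow e * ord_of_nat 2" by (simp add: numeral_2_eq_2 omega1_times_succ)
    also have "\<dots> < omega_pow (succ e)" by (rule times_nat_less)
    also have "\<dots> < omega_pow a" using e by (rule omega_pow_strict_mono)
    finally show ?case .
  qed
qed

lemma limit_ord_omega_pow: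
  assumes "0 < a"
  shows "limit_ord (omega_pow a)"
proof -
  have 1: "1 < omega_pow a" using omega_pow_strict_mono[OF assms] by simp
  then have "succ x < omega_pow a" if "x < omega_pow a" for x
    using omega_pow_add_closed[OF that 1] by simp
  moreover have "omega_pow a \<noteq> 0" using 1 by auto
  ultimately show ?thesis by (simp add: limit_ord_iff)
qed

lemma cnf_value_simps [simp]:
  "cnf_value [] = 0"
  "cnf_value ((a, p) # xs) = omega_pow a * ord_of_nat p + cnf_value xs"
  by (simp_all add: cnf_value_def)

lemma limit_cnf_Cons:
  "limit_cnf ((a, p) # xs) \<longleftrightarrow> 0 < a \<and> 1 \<le> p \<and> (\<forall>x\<in>fst ` set xs. x < a) \<and> limit_cnf xs"
  by (auto simp: limit_cnf_def)

lemma cnf_value_less: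
  "limit_cnf xs \<Longrightarrow> \<forall>x\<in>fst ` set xs. x < e \<Longrightarrow> cnf_value xs < omega_pow e"
proof (induction xs)
  case Nil
  then show ?case using less_succ[of 0] one_le_omega_pow[of e]
    by (simp add: one_eq_succ_zero order.strict_trans2)
next
  case (Cons x xs)
  obtain a p where x: "x = (a, p)" by (cases x)
  have "omega_pow a * ord_of_nat p < omega_pow (succ a)" by (rule times_nat_less)
  also have "\<dots> \<le> omega_pow e" using Cons.prems x by (intro omega_pow_mono) (simp add: succ_le_iff)
  finally show ?case using Cons x by (simp add: omega_pow_add_closed limit_cnf_Cons)
qed

lemma omega_pow_times_nat_ge: "1 \<le> p \<Longrightarrow> omega_pow a \<le> omega_pow a * ord_of_nat p"
  using times_add_nat[of "omega_pow a" 1 "p - 1"]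
    le_plus_omega1[of "omega_pow a * ord_of_nat 1" "omega_pow a * ord_of_nat (p - 1)"]
  by (simp add: omega1_times_succ)

lemma cnf_lead_less:
  assumes "limit_cnf ((a, p) # xs)" "limit_cnf ((b, q) # ys)" "a < b \<or> a = b \<and> p < q"
  shows "cnf_value ((a, p) # xs) < cnf_value ((b, q) # ys)"
proof -
  have "cnf_value ((a, p) # xs) < omega_pow b * ord_of_nat q"
  proof (cases "a < b")
    case True
    have "cnf_value ((a, p) # xs) < omega_pow b"
      using assms(1) True by (intro cnf_value_less) (auto simp: limit_cnf_Cons intro: order.strict_trans)
    also have "\<dots> \<le> omega_pow b * ord_of_nat q"
      using assms(2) by (intro omega_pow_times_nat_ge) (simp add: limit_cnf_Cons)
    finally show ?thesis .
  next
    case False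
    then have [simp]: "b = a" and pq: "p < q" using assms(3) by auto
    have "cnf_value xs < omega_pow a"
      using assms(1) by (intro cnf_value_less) (auto simp: limit_cnf_Cons)
    also have "\<dots> \<le> omega_pow a * ord_of_nat (q - p)"
      using pq by (intro omega_pow_times_nat_ge) simp
    finally have "cnf_value ((a, p) # xs) < omega_pow a * ord_of_nat p + omega_pow a * ord_of_nat (q - p)"
      by simp
    also have "\<dots> = omega_pow b * ord_of_nat q" using pq by (simp add: times_add_nat)
    finally show ?thesis .
  qed
  also have "\<dots> \<le> cnf_value ((b, q) # ys)" by (simp add: le_plus_omega1)
  finally show ?thesis .
qed

lemma cnf_value_inject:
  "limit_cnf xs \<Longrightarrow> limit_cnf ys \<Longrightarrow> cnf_value xs = cnf_value ys \<Longrightarrow> xs = ys"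
proof (induction xs arbitrary: ys)
  case Nil
  show ?case
  proof (cases ys)
    case (Cons y zs)
    obtain b q where y: "y = (b, q)" by (cases y)
    have "omega_pow b \<le> cnf_value ys"
      using Nil Cons y omega_pow_times_nat_ge[of q b] le_plus_omega1[of "omega_pow b * ord_of_nat q" "cnf_value zs"]
      by (auto simp: limit_cnf_Cons intro: order.trans)
    then show ?thesis
      using Nil one_le_omega_pow[of b] less_succ[of 0] by (auto simp: one_eq_succ_zero)
  qed simp
next
  case (Cons x xs)
  obtain a p where x: "x = (a, p)" by (cases x)
  show ?case
  proof (cases ys)
    case Nil
    have "omega_pow a \<le> cnf_value (x # xs)"
      using Cons.prems x omega_pow_times_nat_ge[of p a] le_plus_omega1[of "omega_pow a * ord_of_nat p" "cnf_value xs"]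
      by (auto simp: limit_cnf_Cons intro: order.trans)
    then show ?thesis
      using Cons.prems Nil one_le_omega_pow[of a] less_succ[of 0] by (auto simp: one_eq_succ_zero)
  next
    case ys: (Cons y zs)
    obtain b q where y: "y = (b, q)" by (cases y)
    have "a = b \<and> p = q"
      using cnf_lead_less[of a p xs b q zs] cnf_lead_less[of b q zs a p xs] Cons.prems
      unfolding x y ys by (metis linorder_neqE order.strict_implies_not_eq)
    then show ?thesis using Cons by (simp add: x y ys limit_cnf_Cons)
  qed
qed

lemma omega_pow_between: "omega_pow a < omega_pow b \<Longrightarrow> omega_pow b < omega_pow (succ a) \<Longrightarrow> False"
  by (metis not_le omega_pow_mono succ_le_iff)

lemma limit_ord_neq [simp]: "\<not> limit_ord 0" "\<not> limit_ord (succ a)"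
  by (auto simp: limit_ord_def succ_ord_def)

lemma succ_neq_zero [simp]: "succ a \<noteq> 0" "0 \<noteq> succ a"
  using less_succ[of a] by (metis not_less_zero_omega1)+

lemma one_omega1_simps [simp]: "(1 :: omega1) \<noteq> 0" "(0 :: omega1) \<noteq> 1" "\<not> limit_ord 1"
  by (simp_all add: one_eq_succ_zero)

lemma omega_pow_succ_limit [simp]: "limit_ord (omega_pow (succ a))"
  by (rule limit_ord_omega_pow) (simp add: order.strict_iff_order)

lemma omega_pow_limit_limit: "limit_ord a \<Longrightarrow> limit_ord (omega_pow a)"
  by (rule limit_ord_omega_pow) (simp add: limit_ord_def order.strict_iff_order)

lemma schreier_0_iff: "schreier L 0 s \<longleftrightarrow> s = {}"
proof
  have pow: "(0 :: omega1) \<noteq> omega_pow a" for a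
    using one_le_omega_pow[of a] less_succ[of 0] by (auto simp: one_eq_succ_zero)
  assume "schreier L 0 s"
  then show "s = {}"
  proof cases
    case (pow_succ ss b)
    then show ?thesis using pow by blast
  next
    case (pow_limit l)
    then show ?thesis using pow by blast
  qed simp_all
qed (simp add: schreier.zero)

lemma schreier_succ_iff:
  "schreier L (\<zeta> + 1) s \<longleftrightarrow> (\<exists>n t. s = {n} \<union> t \<and> 1 \<le> n \<and> set_less {n} t \<and> schreier L \<zeta> t)"
  (is "?l \<longleftrightarrow> ?r")
proof
  assume ?l
  then show ?r
  proof cases
    case (one n)
    then have "\<zeta> = 0" by simp (simp add: one_eq_succ_zero)
    then show ?thesis using one by (intro exI[of _ n] exI[of _ "{}"]) (simp add: set_less_def schreier.zero)
  next
    case (succ n t z)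
    then show ?thesis by (intro exI[of _ n] exI[of _ t]) simp
  next
    case (pow_succ ss b)
    then have "omega_pow (succ b) = succ \<zeta>" by simp
    then show ?thesis using omega_pow_succ_limit[of b] by (simp del: omega_pow_succ_limit)
  next
    case (pow_limit l)
    then have "omega_pow l = succ \<zeta>" by simp
    then show ?thesis using omega_pow_limit_limit[OF pow_limit(2)] by simp
  qed simp_all
qed (use schreier.succ in blast)

lemma schreier_1_iff: "schreier L 1 s \<longleftrightarrow> (\<exists>n\<ge>1. s = {n})"
proof -
  have "0 + 1 = (1 :: omega1)" by (rule omega1_zero_plus)
  then show ?thesis
    using schreier_succ_iff[of L 0 s] by (auto simp: schreier_0_iff set_less_def simp del: omega1_plus_one)
qed

lemma schreier_pow_succ_iff:
  "schreier L (omega_pow (\<beta> + 1)) s \<longleftrightarrow> (\<exists>ss. s = \<Union> (set ss) \<and> ss \<noteq> [] \<and> length ss = Min (hd ss) \<and>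
     sorted_wrt set_less ss \<and> (\<forall>s\<in>set ss. schreier L (omega_pow \<beta>) s))"
  (is "?l \<longleftrightarrow> ?r")
proof
  have lim: "limit_ord (omega_pow (\<beta> + 1))" by simp
  assume ?l
  then show ?r
  proof cases
    case zero
    then show ?thesis using lim by simp
  next
    case (one n)
    then show ?thesis using lim by (simp del: omega1_plus_one)
  next
    case (succ n t \<zeta>)
    then show ?thesis using lim by simp
  next
    case (pow_succ ss b)
    then have "b = \<beta>" by simp
    then show ?thesis using pow_succ by (intro exI[of _ ss]) simp
  next
    case (pow_limit l)
    then show ?thesis by auto
  next
    case (cnf \<alpha> p xs ss)
    have "omega_pow \<alpha> < omega_pow (\<beta> + 1)" "omega_pow (\<beta> + 1) < omega_pow (succ \<alpha>)"
      using cnf by simp_all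
    then show ?thesis using omega_pow_between by blast
  qed
qed (use schreier.pow_succ in blast)

lemma schreier_pow_limit_iff:
  assumes "limit_ord l"
  shows "schreier L (omega_pow l) s \<longleftrightarrow> s \<noteq> {} \<and> schreier L (omega_pow (L l (Min s))) s"
  (is "?l \<longleftrightarrow> ?r")
proof
  have lim: "limit_ord (omega_pow l)" using assms by (rule omega_pow_limit_limit)
  assume ?l
  then show ?r
  proof cases
    case (cnf \<alpha> p xs ss)
    have "omega_pow \<alpha> < omega_pow l" "omega_pow l < omega_pow (succ \<alpha>)"
      using cnf by simp_all
    then show ?thesis using omega_pow_between by blast
  qed (use lim assms in auto)
qed (use assms schreier.pow_limit in blast)

lemma schreier_cnf_iff:
  assumes "omega_pow \<alpha> < \<xi>" "\<xi> < omega_pow (\<alpha> + 1)" "limit_ord \<xi>" "0 < \<alpha>"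
    and "limit_cnf ((\<alpha>, p) # xs)" "\<xi> = cnf_value ((\<alpha>, p) # xs)"
  shows "schreier L \<xi> s \<longleftrightarrow> (\<exists>ss. s = \<Union> (set ss) \<and> length ss = length ((\<alpha>, p) # xs) \<and>
     sorted_wrt (\<lambda>s t. set_less t s) ss \<and>
     (\<forall>i<length ss. \<exists>ts. length ts = snd (((\<alpha>, p) # xs) ! i) \<and> sorted_wrt set_less ts \<and>
       (\<forall>t\<in>set ts. schreier L (omega_pow (fst (((\<alpha>, p) # xs) ! i))) t) \<and> ss ! i = \<Union> (set ts)))"
  (is "?l \<longleftrightarrow> ?r")
proof
  assume ?l
  then show ?r
  proof cases
    case (pow_succ ss \<beta>)
    then show ?thesis using assms(1,2) omega_pow_between[of \<alpha> "\<beta> + 1"] by simp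
  next
    case (pow_limit l)
    then show ?thesis using assms(1,2) omega_pow_between[of \<alpha> l] by simp
  next
    case (cnf \<alpha>' p' xs' ss)
    have "(\<alpha>', p') # xs' = (\<alpha>, p) # xs"
      using cnf assms by (intro cnf_value_inject) simp_all
    then show ?thesis using cnf by (intro exI[of _ ss]) simp
  qed (use assms(3) in auto)
next
  assume ?r
  then show ?l
    by (elim exE conjE) (erule ssubst, rule schreier.cnf[OF assms(3,4,1,2,5,6)], assumption+)
qed

definition schreier_family :: "(omega1 \<Rightarrow> nat \<Rightarrow> omega1) \<Rightarrow> omega1 \<Rightarrow> nat set set" where
  "schreier_family L \<xi> = {s. schreier L \<xi> s}"


section \<open>Words and reductions\<close>

definition words :: "'a set \<Rightarrow> 'a list set" where
  "words \<Sigma> = {w. w \<noteq> [] \<and> set w \<subseteq> \<Sigma>}"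

definition var_words :: "'a set \<Rightarrow> 'a \<Rightarrow> 'a list set" where
  "var_words \<Sigma> \<upsilon> = words (insert \<upsilon> \<Sigma>) - words \<Sigma>"

definition subst_word :: "'a \<Rightarrow> 'a list \<Rightarrow> 'a \<Rightarrow> 'a list" where
  "subst_word \<upsilon> w \<alpha> = map (\<lambda>x. if x = \<upsilon> then \<alpha> else x) w"

text \<open>Sequences of words are indexed from 0 (so \<open>w n\<close> stands for \<open>w\<^sub>n\<^sub>+\<^sub>1\<close>), but the positions in
  \<open>dset\<close> are counted from 1: the term with index \<open>i\<close> starts at position
  \<open>1 + (\<Sum>j<i. length (ws ! j))\<close> of the concatenation of \<open>ws\<close>.\<close>

definition dset :: "'a list list \<Rightarrow> nat set" where
  "dset ws = (\<lambda>i. 1 + (\<Sum>j<i. length (ws ! j))) ` {1..<length ws}"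

text \<open>\<open>reduce_block \<upsilon> w k t\<close> is the term contributed by a word \<open>t\<close> preceded by exactly \<open>k\<close> letters.\<close>

definition reduce_block :: "'a \<Rightarrow> (nat \<Rightarrow> 'a list) \<Rightarrow> nat \<Rightarrow> 'a list \<Rightarrow> 'a list" where
  "reduce_block \<upsilon> w k t = concat (map (\<lambda>m. subst_word \<upsilon> (w (k + m)) (t ! m)) [0..<length t])"

definition reduce_fin :: "'a \<Rightarrow> (nat \<Rightarrow> 'a list) \<Rightarrow> 'a list list \<Rightarrow> 'a list list" where
  "reduce_fin \<upsilon> w ts = map (\<lambda>i. reduce_block \<upsilon> w (\<Sum>j<i. length (ts ! j)) (ts ! i)) [0..<length ts]"

definition reduce_inf :: "'a \<Rightarrow> (nat \<Rightarrow> 'a list) \<Rightarrow> (nat \<Rightarrow> 'a list) \<Rightarrow> nat \<Rightarrow> 'a list" where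
  "reduce_inf \<upsilon> w t i = reduce_block \<upsilon> w (\<Sum>j<i. length (t j)) (t i)"

definition RW :: "'a set \<Rightarrow> 'a \<Rightarrow> (nat \<Rightarrow> 'a list) \<Rightarrow> 'a list list set" where
  "RW \<Sigma> \<upsilon> w = reduce_fin \<upsilon> w ` lists (words \<Sigma>)"

definition VRW :: "'a set \<Rightarrow> 'a \<Rightarrow> (nat \<Rightarrow> 'a list) \<Rightarrow> 'a list list set" where
  "VRW \<Sigma> \<upsilon> w = reduce_fin \<upsilon> w ` lists (var_words \<Sigma> \<upsilon>)"

definition var_reduction :: "'a set \<Rightarrow> 'a \<Rightarrow> (nat \<Rightarrow> 'a list) \<Rightarrow> (nat \<Rightarrow> 'a list) \<Rightarrow> bool" where
  "var_reduction \<Sigma> \<upsilon> u w \<longleftrightarrow> (\<exists>t. (\<forall>n. t n \<in> var_words \<Sigma> \<upsilon>) \<and> u = reduce_inf \<upsilon> w t)"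

text \<open>The Schreier sequences with terms from \<open>X\<close>, where \<open>X\<close> is \<open>words \<Sigma>\<close> or \<open>var_words \<Sigma> \<upsilon>\<close>.\<close>

definition schreier_seqs ::
    "(omega1 \<Rightarrow> nat \<Rightarrow> omega1) \<Rightarrow> omega1 \<Rightarrow> 'a list set \<Rightarrow> 'a list list set" where
  "schreier_seqs L \<xi> X =
     (if \<xi> = 0 then {[x] |x. x \<in> X}
      else {ws \<in> lists X. ws \<noteq> [] \<and> dset ws \<in> schreier_family L \<xi>})"

end

theory Submission
  imports Defs "HOL-Analysis.Function_Topology" "HOL-Library.Stream"
begin

text \<open>Only two properties of \<open>W\<^sup>\<xi>\<close> matter: its terms are non-empty words, and it is thin, that is, no
  member properly extends another, because no member of \<open>\<A>\<^sub>\<xi>\<close> is a proper initial segment of another.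
  For one-term sequences the theorem is Carlson's: in the semigroup of ultrafilters on words there are
  idempotents \<open>q \<le> p\<close>, with \<open>p\<close> minimal on constant words and \<open>q\<close> on variable words; minimality forces
  every substitution instance of \<open>q\<close> to be \<open>p\<close>, so variable words can be chosen one after the other with
  all reductions in a set that is large for both.  With this pigeonhole principle, Nash-Williams'
  argument of accepting and rejecting finite sequences shows that, after passing to a variable
  reduction, a family of finite sequences either contains no finite reduction, or contains an initial
  segment of every infinite one.  Applied to the colour classes of a thin family, the second
  alternative for one class excludes all the others.\<close>


section \<open>Compact right topological semigroups\<close>

instance "fun" :: (type, t2_space) t2_space
proof
  fix f g :: "'a \<Rightarrow> 'b"
  assume "f \<noteq> g"
  then obtain i where "f i \<noteq> g i" by blast
  then obtain U V where UV: "open U" "open V" "f i \<in> U" "g i \<in> V" "U \<inter> V = {}"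
    using hausdorff by metis
  have "open ((\<lambda>h. h i) -` W)" if "open W" for W :: "'b set"
    using that continuous_on_product_coordinates by (rule open_vimage)
  then show "\<exists>U V. open U \<and> open V \<and> f \<in> U \<and> g \<in> V \<and> U \<inter> V = {}"
    using UV by (intro exI[of _ "(\<lambda>h. h i) -` U"] exI[of _ "(\<lambda>h. h i) -` V"]) auto
qed

lemma compact_fun_UNIV:
  assumes "compact (UNIV :: 'b set)"
  shows "compact (UNIV :: ('a \<Rightarrow> 'b::topological_space) set)"
proof -
  have "compact_space (product_topology (\<lambda>_. euclidean) UNIV :: ('a \<Rightarrow> 'b) topology)"
    using assms unfolding compact_space_product_topology by (simp add: compact_space_def)
  then show ?thesis by (simp add: euclidean_product_topology compact_space_def)
qed

text \<open>Zorn's lemma and compactness: a finite subfamily of a chain has its intersection as a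
  member, so the chain has the finite intersection property. It serves for closed subsemigroups and
  for closed left ideals.\<close>

lemma minimal_closed_set:
  fixes P :: "'b::topological_space set \<Rightarrow> bool"
  assumes "compact (UNIV :: 'b set)" and "P C"
    and closed: "\<And>X. P X \<Longrightarrow> closed X" and nonempty: "\<And>X. P X \<Longrightarrow> X \<noteq> {}"
    and Inter: "\<And>\<C>. \<C> \<noteq> {} \<Longrightarrow> (\<And>X. X \<in> \<C> \<Longrightarrow> P X) \<Longrightarrow> \<Inter>\<C> \<noteq> {} \<Longrightarrow> P (\<Inter>\<C>)"
  obtains M where "M \<subseteq> C" "P M" "\<And>X. X \<subseteq> M \<Longrightarrow> P X \<Longrightarrow> X = M"
proof -
  \<comment> \<open>Passing to complements turns minimal sets into maximal ones, as Zorn's lemma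
    requires.\<close>
  define \<A> where "\<A> = {Y. P (- Y) \<and> - Y \<subseteq> C}"
  have "\<exists>M\<in>\<A>. \<forall>X\<in>\<A>. M \<subseteq> X \<longrightarrow> X = M"
  proof (rule subset_Zorn_nonempty)
    have "- C \<in> \<A>" using \<open>P C\<close> by (simp add: \<A>_def)
    then show "\<A> \<noteq> {}" by blast
    fix \<C> assume ne: "\<C> \<noteq> {}" and "subset.chain \<A> \<C>"
    then have sub: "\<C> \<subseteq> \<A>" and tot: "\<And>X Y. X \<in> \<C> \<Longrightarrow> Y \<in> \<C> \<Longrightarrow> X \<subseteq> Y \<or> Y \<subseteq> X"
      by (auto simp: subset_chain_def)
    have P: "P X" if "X \<in> uminus ` \<C>" for X using that sub by (auto simp: \<A>_def)
    have "UNIV \<inter> \<Inter>(uminus ` \<C>) \<noteq> {}"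
    proof (rule compact_imp_fip[OF assms(1)])
      fix F assume F: "finite F" "F \<subseteq> uminus ` \<C>"
      show "UNIV \<inter> \<Inter>F \<noteq> {}"
      proof (cases "F = {}")
        case False
        have "subset.chain UNIV F"
          unfolding subset_chain_def
        proof (intro conjI ballI)
          fix X Y assume "X \<in> F" "Y \<in> F"
          then have "- X \<in> \<C>" "- Y \<in> \<C>" using F(2) by auto
          then show "X \<subseteq> Y \<or> Y \<subseteq> X" using tot[of "- X" "- Y"] by auto
        qed simp
        then have "\<Inter>F \<in> F" using F(1) False by (intro Inter_in_chain)
        then have "P (\<Inter>F)" using F(2) P by blast
        then show ?thesis using nonempty[of "\<Inter>F"] by simp
      qed simp
    qed (use P closed in blast)
    then have "P (\<Inter>(uminus ` \<C>))" using P ne by (intro Inter) auto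
    moreover have "\<Inter>(uminus ` \<C>) = - \<Union>\<C>" by auto
    moreover have "- \<Union>\<C> \<subseteq> C" using ne sub unfolding \<A>_def by blast
    ultimately show "\<Union>\<C> \<in> \<A>" by (simp add: \<A>_def)
  qed
  then obtain M where M: "M \<in> \<A>" "\<And>X. X \<in> \<A> \<Longrightarrow> M \<subseteq> X \<Longrightarrow> X = M" by blast
  have "X = - M" if "X \<subseteq> - M" "P X" for X
  proof -
    have "- X \<in> \<A>" using that M(1) by (auto simp: \<A>_def)
    then have "- X = M" using that(1) M(2) by blast
    then show ?thesis by blast
  qed
  then show ?thesis using that[of "- M"] M(1) by (simp add: \<A>_def)
qed

locale compact_right_semigroup =
  fixes mul :: "'b::t2_space \<Rightarrow> 'b \<Rightarrow> 'b" (infixl "\<odot>" 70)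
  assumes compact: "compact (UNIV :: 'b set)"
    and assoc: "x \<odot> y \<odot> z = x \<odot> (y \<odot> z)"
    and cont: "continuous_on UNIV (\<lambda>x. x \<odot> y)"
begin

definition subsemigroup where
  "subsemigroup C \<longleftrightarrow> closed C \<and> C \<noteq> {} \<and> (\<forall>x\<in>C. \<forall>y\<in>C. x \<odot> y \<in> C)"

lemma closed_translate: "closed C \<Longrightarrow> closed ((\<lambda>x. x \<odot> y) ` C)"
  using compact compact_Int_closed[of UNIV C] continuous_on_subset[OF cont]
  by (intro compact_imp_closed compact_continuous_image) auto

text \<open>Ellis-Numakura: in a minimal closed subsemigroup \<open>M\<close> with \<open>e\<close>
  in \<open>M\<close>, the translate of \<open>M\<close> by \<open>e\<close> is all of
  \<open>M\<close>. Hence the solutions in \<open>M\<close> of \<open>x \<odot> e = e\<close> form a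
  closed subsemigroup, which by minimality is \<open>M\<close> and contains
  \<open>e\<close>.\<close>

lemma idempotent_exists:
  assumes "subsemigroup C"
  shows "\<exists>e\<in>C. e \<odot> e = e"
proof -
  obtain M where M: "M \<subseteq> C" "subsemigroup M" "\<And>X. X \<subseteq> M \<Longrightarrow> subsemigroup X \<Longrightarrow> X = M"
    by (rule minimal_closed_set[of subsemigroup C, OF compact assms])
       (auto simp: subsemigroup_def closed_Inter)
  obtain e where e: "e \<in> M" using M(2) by (auto simp: subsemigroup_def)
  have "subsemigroup ((\<lambda>x. x \<odot> e) ` M)"
    using M(2) e closed_translate unfolding subsemigroup_def
    by (auto simp flip: assoc)
  moreover have "(\<lambda>x. x \<odot> e) ` M \<subseteq> M" using M(2) e by (auto simp: subsemigroup_def)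
  ultimately have "(\<lambda>x. x \<odot> e) ` M = M" by (rule M(3)[rotated])
  then obtain d where d: "d \<in> M" "d \<odot> e = e" using e by (metis imageE)
  have "subsemigroup {x\<in>M. x \<odot> e = e}"
  proof -
    have "closed (M \<inter> {x. x \<odot> e = e})"
      using M(2) by (intro closed_Int closed_Collect_eq cont continuous_on_const)
        (simp add: subsemigroup_def)
    moreover have "M \<inter> {x. x \<odot> e = e} = {x\<in>M. x \<odot> e = e}" by auto
    ultimately show ?thesis using M(2) d by (auto simp: subsemigroup_def assoc)
  qed
  then have "{x\<in>M. x \<odot> e = e} = M" by (intro M(3)) auto
  then show ?thesis using e M(1) by blast
qed

text \<open>Take \<open>p\<close> in a minimal closed left ideal \<open>M\<close>. An idempotent
  \<open>e\<close> below \<open>p\<close> lies in \<open>M\<close>, so the left ideal of all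
  \<open>t \<odot> e\<close> is \<open>M\<close> and contains \<open>p\<close>. This gives
  \<open>p \<odot> e = p\<close>, while \<open>p \<odot> e = e\<close>.\<close>

lemma minimal_idempotent_exists:
  assumes T: "subsemigroup T"
  obtains p where "p \<in> T" "p \<odot> p = p"
    "\<And>e. e \<in> T \<Longrightarrow> e \<odot> e = e \<Longrightarrow> e \<odot> p = e \<Longrightarrow> p \<odot> e = e \<Longrightarrow> e = p"
proof -
  define left_ideal where
    "left_ideal C \<longleftrightarrow> closed C \<and> C \<noteq> {} \<and> C \<subseteq> T \<and> (\<forall>x\<in>T. \<forall>y\<in>C. x \<odot> y \<in> C)" for C
  have left_ideal_T: "left_ideal T" using T by (auto simp: left_ideal_def subsemigroup_def)
  have left_ideal_Inter: "left_ideal (\<Inter>\<C>)"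
    if "\<C> \<noteq> {}" "\<And>X. X \<in> \<C> \<Longrightarrow> left_ideal X" "\<Inter>\<C> \<noteq> {}" for \<C>
    using that unfolding left_ideal_def by (intro conjI closed_Inter) blast+
  obtain M where M: "M \<subseteq> T" "left_ideal M" "\<And>X. X \<subseteq> M \<Longrightarrow> left_ideal X \<Longrightarrow> X = M"
    by (rule minimal_closed_set[of left_ideal T, OF compact left_ideal_T])
      (simp_all add: left_ideal_Inter, simp_all add: left_ideal_def)
  have "subsemigroup M" using M(2) by (auto simp: left_ideal_def subsemigroup_def)
  then obtain p where p: "p \<in> M" "p \<odot> p = p" using idempotent_exists by blast
  have "e = p" if e: "e \<in> T" "e \<odot> e = e" "e \<odot> p = e" "p \<odot> e = e" for e
  proof -
    have "e \<in> M" using e(1,3) p(1) M(2) unfolding left_ideal_def by metis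
    moreover have "left_ideal ((\<lambda>x. x \<odot> e) ` T)"
      using T e(1) closed_translate unfolding left_ideal_def subsemigroup_def
      by (auto simp flip: assoc)
    moreover have "(\<lambda>x. x \<odot> e) ` T \<subseteq> M" using \<open>e \<in> M\<close> M(2) by (auto simp: left_ideal_def)
    ultimately have "p \<in> (\<lambda>x. x \<odot> e) ` T" using M(3) p(1) by blast
    then obtain t where "p = t \<odot> e" by blast
    then have "p \<odot> e = p" using e(2) by (simp add: assoc)
    then show ?thesis using e(4) by simp
  qed
  then show ?thesis using that p M(1) by blast
qed

text \<open>The right translate of \<open>I\<close> by \<open>p\<close> is a closed subsemigroup.
  Multiplying one of its idempotents by \<open>p\<close> on the left gives an idempotent below
  \<open>p\<close>. The two-sided translate might fail to be closed, since left multiplication need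
  not be continuous.\<close>

lemma idempotent_below_in_ideal:
  assumes "p \<odot> p = p" and S: "subsemigroup S" "p \<in> S" and I: "closed I" "I \<noteq> {}"
    and ideal: "\<And>x y. x \<in> I \<Longrightarrow> y \<in> S \<Longrightarrow> x \<odot> y \<in> I" "\<And>x y. x \<in> S \<Longrightarrow> y \<in> I \<Longrightarrow> x \<odot> y \<in> I"
    and "I \<subseteq> S"
  obtains q where "q \<in> I" "q \<odot> q = q" "p \<odot> q = q" "q \<odot> p = q"
proof -
  have "x \<odot> p \<odot> (y \<odot> p) \<in> (\<lambda>x. x \<odot> p) ` I" if "x \<in> I" "y \<in> I" for x y
    using that ideal S(2) \<open>I \<subseteq> S\<close> by (auto simp flip: assoc intro!: imageI)
  then have "subsemigroup ((\<lambda>x. x \<odot> p) ` I)"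
    using I closed_translate unfolding subsemigroup_def by auto
  then obtain x where x: "x \<in> I" "(x \<odot> p) \<odot> (x \<odot> p) = x \<odot> p"
    using idempotent_exists by blast
  have pp: "p \<odot> (p \<odot> z) = p \<odot> z" for z using assms(1) assoc[of p p z] by simp
  have xp: "x \<odot> (p \<odot> (x \<odot> p)) = x \<odot> p" using x(2) by (simp add: assoc)
  show ?thesis
  proof
    show "p \<odot> (x \<odot> p) \<in> I" using x(1) S(2) ideal by blast
    show "p \<odot> (x \<odot> p) \<odot> (p \<odot> (x \<odot> p)) = p \<odot> (x \<odot> p)"
      by (simp add: assoc pp xp)
    show "p \<odot> (p \<odot> (x \<odot> p)) = p \<odot> (x \<odot> p)" "p \<odot> (x \<odot> p) \<odot> p = p \<odot> (x \<odot> p)"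
      by (simp_all add: assoc pp assms(1))
  qed
qed

end


section \<open>Reductions of streams of words\<close>

locale alphabet =
  fixes \<Sigma> :: "'a set" and \<upsilon> :: 'a
  assumes finite_alphabet: "finite \<Sigma>" and alphabet_nonempty: "\<Sigma> \<noteq> {}" and var_notin: "\<upsilon> \<notin> \<Sigma>"
begin

text \<open>The flag \<open>b\<close> lets constant and variable words share all later
  proofs.\<close>

definition wrd :: "bool \<Rightarrow> 'a list set" where
  "wrd b = {t. t \<noteq> [] \<and> set t \<subseteq> insert \<upsilon> \<Sigma> \<and> (\<upsilon> \<in> set t \<longleftrightarrow> b)}"

lemma words_eq_wrd: "words \<Sigma> = wrd False"
  using var_notin by (auto simp: words_def wrd_def)

lemma var_words_eq_wrd: "var_words \<Sigma> \<upsilon> = wrd True"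
  using var_notin by (auto simp: var_words_def words_def wrd_def)

lemma wrd_nonempty: "wrd b \<noteq> {}"
proof -
  obtain a where "a \<in> \<Sigma>" using alphabet_nonempty by blast
  then have "[if b then \<upsilon> else a] \<in> wrd b" using var_notin by (auto simp: wrd_def)
  then show ?thesis by blast
qed

text \<open>On streams, what remains after some letters are consumed is again a stream, so
  structural recursion replaces the arithmetic of positions.\<close>

primrec red_word :: "'a list \<Rightarrow> 'a list stream \<Rightarrow> 'a list" where
  "red_word [] y = []"
| "red_word (a # t) y = subst_word \<upsilon> (shd y) a @ red_word t (stl y)"

primrec red_list :: "'a list list \<Rightarrow> 'a list stream \<Rightarrow> 'a list list" where
  "red_list [] y = []"
| "red_list (t # ts) y = red_word t y # red_list ts (sdrop (length t) y)"

primcorec reduction :: "'a list stream \<Rightarrow> 'a list stream \<Rightarrow> 'a list stream" where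
  "shd (reduction y \<tau>) = red_word (shd \<tau>) y"
| "stl (reduction y \<tau>) = reduction (sdrop (length (shd \<tau>)) y) (stl \<tau>)"

lemma subst_word_append: "subst_word \<upsilon> (s @ t) a = subst_word \<upsilon> s a @ subst_word \<upsilon> t a"
  by (simp add: subst_word_def)

lemma length_subst_word [simp]: "length (subst_word \<upsilon> t a) = length t"
  by (simp add: subst_word_def)

lemma subst_word_subst_word:
  "subst_word \<upsilon> (subst_word \<upsilon> t b) a = subst_word \<upsilon> t (if b = \<upsilon> then a else b)"
  by (simp add: subst_word_def)

lemma subst_word_var [simp]: "subst_word \<upsilon> t \<upsilon> = t"
  by (simp add: subst_word_def map_idI)

lemma red_word_append:
  "red_word (s @ t) y = red_word s y @ red_word t (sdrop (length s) y)"
  by (induction s arbitrary: y) simp_all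

text \<open>Every \<open>\<upsilon>\<close> in the reduced word stems from a letter
  \<open>\<upsilon>\<close> of \<open>t\<close>, so substituting afterwards amounts to substituting
  in \<open>t\<close>.\<close>

lemma subst_red_word: "subst_word \<upsilon> (red_word t y) a = red_word (subst_word \<upsilon> t a) y"
  by (induction t arbitrary: y)
    (simp_all add: subst_word_append subst_word_subst_word, simp_all add: subst_word_def)

lemma red_word_reduction: "red_word t (reduction y \<tau>) = red_word (red_word t \<tau>) y"
  by (induction t arbitrary: y \<tau>) (simp_all add: red_word_append subst_red_word)

lemma sdrop_reduction:
  "sdrop (length t) (reduction y \<tau>) = reduction (sdrop (length (red_word t \<tau>)) y) (sdrop (length t) \<tau>)"
  by (induction t arbitrary: y \<tau>) simp_all

text \<open>This is what makes \<open>reduces\<close> transitive.\<close>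

lemma reduction_assoc: "reduction (reduction y \<tau>) \<sigma> = reduction y (reduction \<tau> \<sigma>)"
  by (coinduction arbitrary: y \<tau> \<sigma>) (auto simp: red_word_reduction sdrop_reduction)

lemma red_list_reduction: "red_list ts (reduction y \<tau>) = red_list (red_list ts \<tau>) y"
  by (induction ts arbitrary: y \<tau>) (simp_all add: red_word_reduction sdrop_reduction)

lemma reduction_sconst: "reduction y (sconst [\<upsilon>]) = y"
  by (coinduction arbitrary: y) simp

lemma var_in_wrd: "[\<upsilon>] \<in> wrd True"
  by (simp add: wrd_def)

lemma set_subst_word:
  "set (subst_word \<upsilon> t a) = (if \<upsilon> \<in> set t then insert a (set t - {\<upsilon>}) else set t)"
  by (auto simp: subst_word_def)

lemma var_in_red_word:
  assumes "\<tau> \<in> streams (wrd True)" "set t \<subseteq> insert \<upsilon> \<Sigma>"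
  shows "\<upsilon> \<in> set (red_word t \<tau>) \<longleftrightarrow> \<upsilon> \<in> set t"
  using assms
proof (induction t arbitrary: \<tau>)
  case (Cons a t)
  have "shd \<tau> \<in> wrd True" "stl \<tau> \<in> streams (wrd True)"
    using Cons.prems streams_shd streams_stl by blast+
  then show ?case using Cons by (auto simp: set_subst_word wrd_def)
qed simp

lemma set_red_word:
  assumes "\<tau> \<in> streams (wrd True)" "set t \<subseteq> insert \<upsilon> \<Sigma>"
  shows "set (red_word t \<tau>) \<subseteq> insert \<upsilon> \<Sigma>"
  using assms
proof (induction t arbitrary: \<tau>)
  case (Cons a t)
  have "shd \<tau> \<in> wrd True" "stl \<tau> \<in> streams (wrd True)"
    using Cons.prems streams_shd streams_stl by blast+
  then show ?case using Cons by (force simp: set_subst_word wrd_def)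
qed simp

lemma red_word_in_wrd:
  assumes "\<tau> \<in> streams (wrd True)" "t \<in> wrd b"
  shows "red_word t \<tau> \<in> wrd b"
proof -
  obtain a s where t: "t = a # s" using assms(2) by (cases t) (auto simp: wrd_def)
  have "shd \<tau> \<noteq> []" using streams_shd[OF assms(1)] by (simp add: wrd_def)
  then have "red_word t \<tau> \<noteq> []" by (simp add: t subst_word_def)
  then show ?thesis
    using assms var_in_red_word[OF assms(1), of t] set_red_word[OF assms(1), of t]
    by (simp add: wrd_def)
qed

lemma sdrop_streams: "\<tau> \<in> streams A \<Longrightarrow> sdrop n \<tau> \<in> streams A"
  by (simp add: streams_iff_snth sdrop_snth)

lemma red_list_in_wrd:
  "\<tau> \<in> streams (wrd True) \<Longrightarrow> ts \<in> lists (wrd b) \<Longrightarrow> red_list ts \<tau> \<in> lists (wrd b)"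
proof (induction ts arbitrary: \<tau>)
  case (Cons t ts)
  have "sdrop (length t) \<tau> \<in> streams (wrd True)"
    using Cons.prems(1) by (rule sdrop_streams)
  then show ?case using Cons red_word_in_wrd[OF Cons.prems(1), of t b] by simp
qed simp

lemma reduction_in_streams:
  assumes "\<tau> \<in> streams (wrd True)" "\<sigma> \<in> streams (wrd b)"
  shows "reduction \<tau> \<sigma> \<in> streams (wrd b)"
proof -
  have "reduction \<tau> \<sigma> !! n \<in> wrd b" for n
    using assms
  proof (induction n arbitrary: \<tau> \<sigma>)
    case 0
    show ?case using red_word_in_wrd[OF 0(1) streams_shd[OF 0(2)]] by simp
  next
    case (Suc n)
    show ?case using Suc.IH[OF sdrop_streams[OF Suc.prems(1)] streams_stl[OF Suc.prems(2)]] by simp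
  qed
  then show ?thesis by (simp add: streams_iff_snth)
qed

section \<open>The reduction relation and its coinduction principle\<close>

definition reduces :: "bool \<Rightarrow> 'a list stream \<Rightarrow> 'a list stream \<Rightarrow> bool" where
  "reduces b x y \<longleftrightarrow> (\<exists>\<tau>\<in>streams (wrd b). x = reduction y \<tau>)"

lemma reduces_refl: "reduces True y y"
  unfolding reduces_def
  by (rule bexI[of _ "sconst [\<upsilon>]"]) (simp_all add: reduction_sconst sconst_streams var_in_wrd)

lemma reduces_trans: "reduces b x y \<Longrightarrow> reduces True y z \<Longrightarrow> reduces b x z"
  unfolding reduces_def by (auto simp: reduction_assoc intro: reduction_in_streams)

lemma reduces_unfold:
  "reduces b x y \<longleftrightarrow> (\<exists>t\<in>wrd b. shd x = red_word t y \<and> reduces b (stl x) (sdrop (length t) y))"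
proof
  assume "reduces b x y"
  then obtain \<tau> where "\<tau> \<in> streams (wrd b)" "x = reduction y \<tau>" by (auto simp: reduces_def)
  then show "\<exists>t\<in>wrd b. shd x = red_word t y \<and> reduces b (stl x) (sdrop (length t) y)"
    using streams_shd[of \<tau>] streams_stl[of \<tau>]
    by (intro bexI[of _ "shd \<tau>"]) (simp_all add: reduces_def, blast)
next
  assume "\<exists>t\<in>wrd b. shd x = red_word t y \<and> reduces b (stl x) (sdrop (length t) y)"
  then obtain t \<tau> where t: "t \<in> wrd b" "shd x = red_word t y" "\<tau> \<in> streams (wrd b)"
    "stl x = reduction (sdrop (length t) y) \<tau>"
    by (auto simp: reduces_def)
  then have "x = reduction y (t ## \<tau>)" by (intro stream.expand) simp
  then show "reduces b x y" using t by (auto simp: reduces_def)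
qed

text \<open>Choosing a word \<open>t\<close> in each state and iterating the passage to tails yields
  the stream that witnesses the reduction.\<close>

lemma reduces_coinduct:
  assumes "R x y"
    and step: "\<And>x y. R x y \<Longrightarrow>
      \<exists>t\<in>wrd b. shd x = red_word t y \<and> R (stl x) (sdrop (length t) y)"
  shows "reduces b x y"
proof -
  define f where "f x y = (SOME t. t \<in> wrd b \<and> shd x = red_word t y \<and>
    R (stl x) (sdrop (length t) y))" for x y
  have f: "f x y \<in> wrd b \<and> shd x = red_word (f x y) y \<and> R (stl x) (sdrop (length (f x y)) y)"
    if "R x y" for x y
    using step[OF that] unfolding f_def Bex_def by (rule someI_ex)
  define next_state where "next_state = (\<lambda>(x, y). (stl x, sdrop (length (f x y)) y))"
  define \<tau> where "\<tau> x y = smap (case_prod f) (siterate next_state (x, y))" for x y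
  have "\<tau> x y !! n \<in> wrd b" for n
    using \<open>R x y\<close>
    by (induction n arbitrary: x y) (simp_all add: \<tau>_def next_state_def f del: snth_smap snth_siterate)
  then have "\<tau> x y \<in> streams (wrd b)" by (simp add: streams_iff_snth)
  moreover have "x = reduction y (\<tau> x y)"
    using \<open>R x y\<close>
    by (coinduction arbitrary: x y) (auto simp: \<tau>_def next_state_def f)
  ultimately show ?thesis by (auto simp: reduces_def)
qed

text \<open>Consuming \<open>t\<close> from \<open>x\<close> amounts to consuming a word
  \<open>s\<close>, the reduction of \<open>t\<close>, from \<open>y\<close>; what remains of
  \<open>x\<close> is still a reduction of what remains of \<open>y\<close>.\<close>

lemma reduces_sdrop:
  assumes "reduces True x y" "t \<in> wrd b"
  obtains s where "s \<in> wrd b" "red_word t x = red_word s y"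
    "reduces True (sdrop (length t) x) (sdrop (length s) y)"
proof -
  obtain \<tau> where "\<tau> \<in> streams (wrd True)" "x = reduction y \<tau>" using assms(1) by (auto simp: reduces_def)
  then show ?thesis
    using that[of "red_word t \<tau>"] red_word_in_wrd[OF _ assms(2)] sdrop_streams[of \<tau> _ "length t"]
    unfolding reduces_def by (simp add: red_word_reduction sdrop_reduction) blast
qed

end


section \<open>Ultrafilters on words and the pigeonhole principle\<close>

text \<open>An ultrafilter is given by its characteristic function; the product topology then
  restricts to that of the Stone-Cech compactification of a discrete space.\<close>

definition ultrafilter :: "('b set \<Rightarrow> bool) \<Rightarrow> bool" where
  "ultrafilter p \<longleftrightarrow> (\<forall>A B. p (A \<inter> B) \<longleftrightarrow> p A \<and> p B) \<and> (\<forall>A. p (- A) \<longleftrightarrow> \<not> p A)"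

lemma ultrafilter_Int: "ultrafilter p \<Longrightarrow> p (A \<inter> B) \<longleftrightarrow> p A \<and> p B"
  and ultrafilter_Compl: "ultrafilter p \<Longrightarrow> p (- A) \<longleftrightarrow> \<not> p A"
  by (simp_all add: ultrafilter_def)

lemma ultrafilter_mono: "ultrafilter p \<Longrightarrow> p A \<Longrightarrow> A \<subseteq> B \<Longrightarrow> p B"
  by (metis ultrafilter_Int inf.absorb_iff1)

lemma ultrafilter_UNIV: "ultrafilter p \<Longrightarrow> p UNIV"
  by (metis ultrafilter_Compl ultrafilter_mono subset_UNIV)

lemma ultrafilter_empty: "ultrafilter p \<Longrightarrow> \<not> p {}"
  by (metis ultrafilter_Compl ultrafilter_UNIV Compl_UNIV_eq)

lemma ultrafilter_cong: "ultrafilter p \<Longrightarrow> p B \<Longrightarrow> A \<inter> B = A' \<inter> B \<Longrightarrow> p A = p A'"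
  by (metis ultrafilter_Int)

lemma ultrafilter_INT:
  assumes "ultrafilter p" "finite I" "\<And>i. i \<in> I \<Longrightarrow> p (A i)"
  shows "p (\<Inter>i\<in>I. A i)"
  using assms(2,3) by (induction I) (simp_all add: ultrafilter_UNIV ultrafilter_Int assms(1))

lemma ultrafilter_principal: "ultrafilter (\<lambda>A. x \<in> A)"
  by (simp add: ultrafilter_def)

lemma clopen_coordinate: "closed {p. p A}" "open {p. p A}" for A :: 'b
proof -
  have "open ((\<lambda>p. p A) -` W)" for W :: "bool set"
    by (rule open_vimage[OF open_discrete continuous_on_product_coordinates])
  from this[of "{True}"] this[of "{False}"] show "closed {p. p A}" "open {p. p A}"
    by (simp_all add: closed_def vimage_def Collect_neg_eq)
qed

text \<open>Each single condition involves finitely many coordinates and is clopen.\<close>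

lemma closed_ultrafilters: "closed {p. ultrafilter p}"
  unfolding ultrafilter_def iff_conv_conj_imp
  by (intro closed_Collect_conj closed_Collect_all closed_Collect_imp closed_Collect_neg
      open_Collect_conj open_Collect_neg clopen_coordinate)

text \<open>This extends concatenation to ultrafilters. Associativity and continuity in
  \<open>p\<close> hold for arbitrary predicates, so the semigroup is the whole product space and
  ultrafilters enter as closed subsets.\<close>

definition conv :: "('a list set \<Rightarrow> bool) \<Rightarrow> ('a list set \<Rightarrow> bool) \<Rightarrow> 'a list set \<Rightarrow> bool"
    (infixl "\<odot>" 70) where
  "(p \<odot> q) A \<longleftrightarrow> p {s. q {t. s @ t \<in> A}}"

interpretation conv: compact_right_semigroup conv
proof
  show "compact (UNIV :: ('a list set \<Rightarrow> bool) set)"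
    by (rule compact_fun_UNIV) (simp add: finite_imp_compact)
  show "p \<odot> q \<odot> r = p \<odot> (q \<odot> r)" for p q r :: "'a list set \<Rightarrow> bool"
    by (simp add: fun_eq_iff conv_def)
  show "continuous_on UNIV (\<lambda>p. p \<odot> q)" for q :: "'a list set \<Rightarrow> bool"
    unfolding conv_def by (intro continuous_on_coordinatewise_then_product) simp
qed

lemma ultrafilter_conv: "ultrafilter p \<Longrightarrow> ultrafilter q \<Longrightarrow> ultrafilter (p \<odot> q)"
  by (simp add: ultrafilter_def conv_def flip: Collect_conj_eq Collect_neg_eq) 
     (simp add: Collect_conj_eq Collect_neg_eq)

lemma conv_supersetI:
  assumes "ultrafilter p" "ultrafilter q" "p A" "q B" "\<And>s t. s \<in> A \<Longrightarrow> t \<in> B \<Longrightarrow> s @ t \<in> C"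
  shows "(p \<odot> q) C"
  unfolding conv_def using assms(5)
  by (intro ultrafilter_mono[OF assms(1,3)] subsetI CollectI ultrafilter_mono[OF assms(2,4)]) auto

section \<open>Ultrafilters concentrated on constant or variable words\<close>

context alphabet
begin

text \<open>The closure of \<open>A\<close> in the Stone-Cech compactification.\<close>

definition ultra :: "'a list set \<Rightarrow> ('a list set \<Rightarrow> bool) set" where
  "ultra A = {p. ultrafilter p \<and> p A}"

lemma closed_ultra: "closed (ultra A)"
  unfolding ultra_def by (intro closed_Collect_conj closed_ultrafilters clopen_coordinate)

lemma ultra_nonempty: "A \<noteq> {} \<Longrightarrow> ultra A \<noteq> {}"
  using ultrafilter_principal by (fastforce simp: ultra_def)

lemma ultra_conv:
  "p \<in> ultra A \<Longrightarrow> q \<in> ultra B \<Longrightarrow> (\<And>s t. s \<in> A \<Longrightarrow> t \<in> B \<Longrightarrow> s @ t \<in> C) \<Longrightarrow> p \<odot> q \<in> ultra C"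
  unfolding ultra_def using ultrafilter_conv conv_supersetI by blast

text \<open>The push-forward of \<open>p\<close> under substitution of \<open>a\<close> for
  \<open>\<upsilon>\<close>.\<close>

definition subst_ultra :: "'a \<Rightarrow> ('a list set \<Rightarrow> bool) \<Rightarrow> 'a list set \<Rightarrow> bool" where
  "subst_ultra a p A \<longleftrightarrow> p {s. subst_word \<upsilon> s a \<in> A}"

lemma subst_ultra_conv: "subst_ultra a (p \<odot> q) = subst_ultra a p \<odot> subst_ultra a q"
  by (simp add: fun_eq_iff subst_ultra_def conv_def subst_word_append)

lemma subst_ultra_in_ultra:
  assumes "p \<in> ultra A" "\<And>s. s \<in> A \<Longrightarrow> subst_word \<upsilon> s a \<in> B"
  shows "subst_ultra a p \<in> ultra B"
proof -
  have p: "ultrafilter p" "p A" using assms(1) by (auto simp: ultra_def)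
  have "{s. subst_word \<upsilon> s a \<in> A \<inter> B} = {s. subst_word \<upsilon> s a \<in> A} \<inter> {s. subst_word \<upsilon> s a \<in> B}"
    "{s. subst_word \<upsilon> s a \<in> - A} = - {s. subst_word \<upsilon> s a \<in> A}" for A B by auto
  then have "ultrafilter (subst_ultra a p)"
    using p(1) by (simp add: ultrafilter_def subst_ultra_def)
  then show ?thesis using assms(2) ultrafilter_mono[OF p, of "{s. subst_word \<upsilon> s a \<in> B}"]
    by (auto simp: ultra_def subst_ultra_def)
qed

lemma subst_ultra_words:
  assumes "p \<in> ultra (wrd False)"
  shows "subst_ultra a p = p"
proof
  fix A
  have "subst_word \<upsilon> s a = s" if "s \<in> wrd False" for s
    using that by (auto simp: wrd_def subst_word_def intro!: map_idI)
  then have "{s. subst_word \<upsilon> s a \<in> A} \<inter> wrd False = A \<inter> wrd False" by auto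
  then show "subst_ultra a p A = p A"
    using assms ultrafilter_cong[of p "wrd False" "{s. subst_word \<upsilon> s a \<in> A}" A]
    by (simp add: ultra_def subst_ultra_def)
qed

text \<open>\<open>p\<close> is minimal among the idempotents on constant words only. Within all
  words the ultrafilters on variable words form a two-sided ideal, and this provides
  \<open>q\<close> below \<open>p\<close>.\<close>

lemma variable_idempotent_exists:
  obtains p q where "p \<in> ultra (wrd False)" "q \<in> ultra (wrd True)"
    "p \<odot> p = p" "q \<odot> q = q" "p \<odot> q = q" "q \<odot> p = q" "\<And>a. a \<in> \<Sigma> \<Longrightarrow> subst_ultra a q = p"
proof -
  have app: "s @ t \<in> wrd (b \<or> c)" if "s \<in> wrd b" "t \<in> wrd c" for s t b c
    using that by (auto simp: wrd_def)
  define W where "W = wrd False \<union> wrd True"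
  have W: "W = {t. t \<noteq> [] \<and> set t \<subseteq> insert \<upsilon> \<Sigma>}" by (auto simp: W_def wrd_def)
  have ultra_sub: "ultra A \<subseteq> ultra B" if "A \<subseteq> B" for A B
    using that ultrafilter_mono by (auto simp: ultra_def)
  have sub: "conv.subsemigroup (ultra A)" if "A \<noteq> {}" "\<And>s t. s \<in> A \<Longrightarrow> t \<in> A \<Longrightarrow> s @ t \<in> A" for A
    using that closed_ultra ultra_nonempty ultra_conv[of _ A _ A A] by (simp add: conv.subsemigroup_def)
  have "conv.subsemigroup (ultra (wrd False))"
    using app[of _ False _ False] by (intro sub wrd_nonempty) simp
  then obtain p where p: "p \<in> ultra (wrd False)" "p \<odot> p = p"
    and min: "\<And>e. e \<in> ultra (wrd False) \<Longrightarrow> e \<odot> e = e \<Longrightarrow> e \<odot> p = e \<Longrightarrow> p \<odot> e = e \<Longrightarrow> e = p"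
    by (rule conv.minimal_idempotent_exists) blast
  have "conv.subsemigroup (ultra W)"
  proof (rule sub)
    show "W \<noteq> {}" using wrd_nonempty[of True] by (simp add: W_def)
  qed (auto simp: W)
  note S = this
  have W': "p \<in> ultra W" "ultra (wrd True) \<subseteq> ultra W"
    using p ultra_sub[of _ W] by (auto simp: W_def)
  obtain q where q: "q \<in> ultra (wrd True)" "q \<odot> q = q" "p \<odot> q = q" "q \<odot> p = q"
  proof (rule conv.idempotent_below_in_ideal[OF p(2) S W'(1) closed_ultra ultra_nonempty[OF wrd_nonempty[of True]]])
    show "x \<odot> y \<in> ultra (wrd True)" if "x \<in> ultra (wrd True)" "y \<in> ultra W" for x y
      using that by (rule ultra_conv) (auto simp: W wrd_def)
    show "x \<odot> y \<in> ultra (wrd True)" if "x \<in> ultra W" "y \<in> ultra (wrd True)" for x y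
      using that by (rule ultra_conv) (auto simp: W wrd_def)
  qed (use W'(2) in blast)+
  \<comment> \<open>Substitution is a homomorphism that fixes \<open>p\<close>, so it sends
    \<open>q\<close> to an idempotent below \<open>p\<close>, now concentrated on constant words,
    where \<open>p\<close> is minimal.\<close>
  have "subst_ultra a q = p" if "a \<in> \<Sigma>" for a
  proof (rule min)
    show "subst_ultra a q \<in> ultra (wrd False)"
      using q(1) that var_notin
      by (rule_tac subst_ultra_in_ultra) (auto simp: wrd_def set_subst_word, auto simp: subst_word_def)
  qed (use q subst_ultra_conv[of a] subst_ultra_words[OF p(1), of a] in metis)+
  then show ?thesis using that p q by blast
qed

text \<open>A Galvin-Glazer construction run for \<open>p\<close> and \<open>q\<close> at once: each
  new variable word is chosen by \<open>q\<close>, and substituting a letter of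
  \<open>\<Sigma>\<close> into it behaves like a choice by \<open>p\<close>.\<close>

lemma reductions_in_idempotent_set:
  assumes p: "ultrafilter p" and q: "q \<in> ultra (wrd True)"
    and idem: "p \<odot> p = p" "q \<odot> q = q" "p \<odot> q = q" "q \<odot> p = q"
    and sub: "\<And>a. a \<in> \<Sigma> \<Longrightarrow> subst_ultra a q = p"
    and G: "p G" "q G"
  shows "\<exists>\<tau>\<in>streams (wrd True). \<forall>b. \<forall>t\<in>wrd b. red_word t \<tau> \<in> G"
proof -
  have uq: "ultrafilter q" "q (wrd True)" using q by (auto simp: ultra_def)
  define large where "large A \<longleftrightarrow> p A \<and> q A" for A
  have large_Int: "large (A \<inter> B) \<longleftrightarrow> large A \<and> large B" for A B
    using p uq by (auto simp: large_def ultrafilter_Int)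
  \<comment> \<open>The members of \<open>G\<close> that can be continued within \<open>G\<close> by
    a large set of words; by idempotence they can even be continued within \<open>H\<close>.\<close>
  define H where "H = {x \<in> G. large {y. x @ y \<in> G}}"
  \<comment> \<open>The set of \<open>p\<close> and \<open>q\<close> is closed under products; the
    four products give the four iterated statements.\<close>
  have large_quot: "large {x. large {y. x @ y \<in> A}}" if "large A" for A
  proof -
    have "p {x. p {y. x @ y \<in> A}}" "p {x. q {y. x @ y \<in> A}}"
      "q {x. p {y. x @ y \<in> A}}" "q {x. q {y. x @ y \<in> A}}"
      using idem that unfolding large_def fun_eq_iff conv_def by blast+
    then show ?thesis using p uq(1) by (simp add: large_def Collect_conj_eq ultrafilter_Int)
  qed
  have H_eq: "H = G \<inter> {x. large {y. x @ y \<in> G}}" by (auto simp: H_def)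
  have "large G" using G by (simp add: large_def)
  then have large_H: "large H" unfolding H_eq large_Int using large_quot by blast
  have large_quot_H: "large {y. x @ y \<in> H}" if "x \<in> H" for x
  proof -
    have "large {y. x @ y \<in> G}" using that by (simp add: H_def)
    moreover from large_quot[OF this] have "large {y. large {z. x @ y @ z \<in> G}}" by simp
    moreover have "{y. x @ y \<in> H} = {y. x @ y \<in> G} \<inter> {y. large {z. x @ y @ z \<in> G}}"
      by (auto simp: H_def)
    ultimately show ?thesis by (simp add: large_Int)
  qed
  \<comment> \<open>\<open>Z\<close> holds the finitely many words that must be continued
    next.\<close>
  define inv where "inv Z \<longleftrightarrow> finite Z \<and> (\<forall>z\<in>Z. large {y. z @ y \<in> H})" for Z
  have step: "\<exists>u\<in>wrd True. \<forall>z\<in>Z. \<forall>a\<in>insert \<upsilon> \<Sigma>. z @ subst_word \<upsilon> u a \<in> H" if "inv Z" for Z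
  proof -
    \<comment> \<open>For a letter \<open>a\<close> of \<open>\<Sigma>\<close> this is largeness for
      \<open>p\<close>, the image of \<open>q\<close>; for \<open>a = \<upsilon>\<close> it is
      largeness for \<open>q\<close> itself.\<close>
    have "q {u. z @ subst_word \<upsilon> u a \<in> H}" if "z \<in> Z" "a \<in> insert \<upsilon> \<Sigma>" for z a
    proof -
      have "large {y. z @ y \<in> H}" using \<open>inv Z\<close> that by (simp add: inv_def)
      then have "p {y. z @ y \<in> H}" "q {y. z @ y \<in> H}" by (simp_all add: large_def)
      then show ?thesis
        using that(2) fun_cong[OF sub[of a], of "{y. z @ y \<in> H}"]
        by (cases "a = \<upsilon>") (auto simp: subst_ultra_def)
    qed
    note large = this
    let ?I = "\<Inter>i\<in>Z \<times> insert \<upsilon> \<Sigma>. {u. fst i @ subst_word \<upsilon> u (snd i) \<in> H}"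
    have "q ?I"
    proof (rule ultrafilter_INT[OF uq(1)])
      show "finite (Z \<times> insert \<upsilon> \<Sigma>)" using \<open>inv Z\<close> finite_alphabet by (simp add: inv_def)
      show "q {u. fst i @ subst_word \<upsilon> u (snd i) \<in> H}" if "i \<in> Z \<times> insert \<upsilon> \<Sigma>" for i
        using that by (intro large) auto
    qed
    then have "q (?I \<inter> wrd True)" using uq by (simp only: ultrafilter_Int)
    then have "?I \<inter> wrd True \<noteq> {}" using ultrafilter_empty[OF uq(1)] by metis
    then obtain w where w: "w \<in> ?I" "w \<in> wrd True" by blast
    show ?thesis
    proof (intro bexI[OF _ w(2)] ballI)
      fix z a assume "z \<in> Z" "a \<in> insert \<upsilon> \<Sigma>"
      then have "(z, a) \<in> Z \<times> insert \<upsilon> \<Sigma>" by blast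
      from INT_D[OF w(1) this] show "z @ subst_word \<upsilon> w a \<in> H" by simp
    qed
  qed
  define u where "u Z = (SOME u. u \<in> wrd True \<and>
    (\<forall>z\<in>Z. \<forall>a\<in>insert \<upsilon> \<Sigma>. z @ subst_word \<upsilon> u a \<in> H))" for Z
  have u: "u Z \<in> wrd True" "\<And>z a. z \<in> Z \<Longrightarrow> a \<in> insert \<upsilon> \<Sigma> \<Longrightarrow> z @ subst_word \<upsilon> (u Z) a \<in> H"
    if "inv Z" for Z
    using someI_ex[OF step[OF that, unfolded Bex_def]] unfolding u_def by blast+
  \<comment> \<open>The old words are dropped: \<open>red_word\<close> uses every term of the stream
    in turn, so only words that use all terms so far are continued.\<close>
  define extend where "extend Z = (\<lambda>(z, a). z @ subst_word \<upsilon> (u Z) a) ` (Z \<times> insert \<upsilon> \<Sigma>)" for Z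
  have inv_extend: "inv (extend Z)" if "inv Z" for Z
    unfolding inv_def
  proof (intro conjI ballI)
    show "finite (extend Z)" using that finite_alphabet by (simp add: inv_def extend_def)
    fix x assume "x \<in> extend Z"
    then have "x \<in> H" using u(2)[OF that] by (auto simp: extend_def)
    then show "large {y. x @ y \<in> H}" by (rule large_quot_H)
  qed
  define \<tau> where "\<tau> Z = smap u (siterate extend Z)" for Z
  \<comment> \<open>The empty word need not lie in \<open>H\<close>; it suffices that
    \<open>H\<close> is large. Membership in \<open>H\<close> is therefore claimed below only for
    non-empty \<open>t\<close>.\<close>
  have "inv {[]}" using large_H by (simp add: inv_def)
  have "\<tau> Z !! n \<in> wrd True" if "inv Z" for n Z
    using that
    by (induction n arbitrary: Z) (simp_all add: \<tau>_def u inv_extend del: snth_smap snth_siterate)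
  then have "\<tau> Z \<in> streams (wrd True)" if "inv Z" for Z
    using that by (simp add: streams_iff_snth)
  moreover have "z @ red_word t (\<tau> Z) \<in> H"
    if "inv Z" "z \<in> Z" "t \<noteq> []" "set t \<subseteq> insert \<upsilon> \<Sigma>" for Z z t
    using that
  proof (induction t arbitrary: Z z)
    case (Cons a t)
    let ?z = "z @ subst_word \<upsilon> (u Z) a"
    have z: "?z \<in> H" "?z \<in> extend Z" using Cons.prems u by (auto simp: extend_def)
    have "z @ red_word (a # t) (\<tau> Z) = ?z @ red_word t (\<tau> (extend Z))"
      by (simp add: \<tau>_def)
    also have "\<dots> \<in> H"
      using z Cons.prems Cons.IH[OF inv_extend[OF Cons.prems(1)] z(2)] by (cases "t = []") auto
    finally show ?case .
  qed simp
  from this[of "{[]}" "[]"] have "red_word t (\<tau> {[]}) \<in> G" if "t \<in> wrd b" for t b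
    using \<open>inv {[]}\<close> that by (auto simp: wrd_def H_def)
  ultimately show ?thesis using \<open>inv {[]}\<close> by blast
qed

text \<open>For reductions of a given stream it is applied to \<open>P\<close> composed with
  \<open>red_word\<close>, because reductions compose.\<close>

theorem word_pigeonhole:
  "\<exists>\<tau>\<in>streams (wrd True). (\<forall>t\<in>wrd b. P (red_word t \<tau>)) \<or> (\<forall>t\<in>wrd b. \<not> P (red_word t \<tau>))"
proof -
  obtain p q where pq: "p \<in> ultra (wrd False)" "q \<in> ultra (wrd True)"
    "p \<odot> p = p" "q \<odot> q = q" "p \<odot> q = q" "q \<odot> p = q" "\<And>a. a \<in> \<Sigma> \<Longrightarrow> subst_ultra a q = p"
    by (rule variable_idempotent_exists) blast
  define r where "r = (if b then q else p)"
  have r: "ultrafilter r" "r (wrd b)" "ultrafilter p" "ultrafilter q"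
    using pq by (auto simp: r_def ultra_def)
  have "\<exists>c. r {t. P t = c}"
  proof (cases "r {t. P t}")
    case False
    then have "r {t. \<not> P t}" using ultrafilter_Compl[OF r(1)] by (simp add: Collect_neg_eq)
    then show ?thesis by (intro exI[of _ False]) simp
  qed (intro exI[of _ True], simp)
  then obtain c where c: "r {t. P t = c}" by blast
  \<comment> \<open>The implication puts all words of the other kind into \<open>G\<close>, so
    \<open>G\<close> belongs to both \<open>p\<close> and \<open>q\<close>.\<close>
  define G where "G = {t. t \<in> wrd b \<longrightarrow> P t = c}"
  have "{t. P t = c} \<subseteq> G" by (auto simp: G_def)
  with r(1) c have "r G" by (rule ultrafilter_mono)
  moreover have "wrd (\<not> b) \<subseteq> G" by (auto simp: G_def wrd_def)
  ultimately have "p G" "q G"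
    using pq(1,2) ultrafilter_mono[of p "wrd (\<not> b)" G] ultrafilter_mono[of q "wrd (\<not> b)" G]
    by (cases b; simp add: r_def ultra_def)+
  then obtain \<tau> where "\<tau> \<in> streams (wrd True)" "\<forall>b. \<forall>t\<in>wrd b. red_word t \<tau> \<in> G"
    using reductions_in_idempotent_set[OF r(3) pq(2-7)] by blast
  then show ?thesis using red_word_in_wrd[of \<tau> _ b] by (cases c) (auto simp: G_def)
qed

end


section \<open>Fusion and the dichotomy for families of finite reductions\<close>

context alphabet
begin

section \<open>Fusion of successive reductions\<close>

lemma shrink_finite:
  assumes "finite S"
    and hered: "\<And>s y z. Q s y \<Longrightarrow> reduces True z y \<Longrightarrow> Q s z"
    and dense: "\<And>s y. \<exists>z. reduces True z y \<and> Q s z"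
  shows "\<exists>z. reduces True z y \<and> (\<forall>s\<in>S. Q s z)"
  using assms(1)
proof (induction S)
  case empty
  then show ?case using reduces_refl by blast
next
  case (insert s S)
  then obtain z where z: "reduces True z y" "\<forall>s\<in>S. Q s z" by blast
  obtain z' where z': "reduces True z' z" "Q s z'" using dense by blast
  have "reduces True z' y" using z' z reduces_trans by blast
  moreover have "\<forall>s\<in>insert s S. Q s z'" using z' z hered by blast
  ultimately show ?case by blast
qed

text \<open>Diagonal intersection: \<open>us\<close> are the terms fixed so far, and \<open>f us y\<close> shrinks the remaining
  sequence \<open>y\<close> before its first term is fixed as well.\<close>

primcorec fuse ::
    "('a list list \<Rightarrow> 'a list stream \<Rightarrow> 'a list stream) \<Rightarrow> 'a list list \<Rightarrow> 'a list stream \<Rightarrow> 'a list stream"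
  where
  "shd (fuse f us y) = shd (f us y)"
| "stl (fuse f us y) = fuse f (us @ [shd (f us y)]) (stl (f us y))"

lemma fuse_reduces:
  assumes f: "\<And>us y. reduces True (f us y) y"
  shows "reduces True (fuse f us y) (f us y)"
\<comment> \<open>The target \<open>b\<close> may be larger than \<open>f us y\<close>, since every
  tail is shrunk again before its next term is fixed.\<close>
proof (rule reduces_coinduct[of "\<lambda>a b. \<exists>us y. a = fuse f us y \<and> reduces True (f us y) b"])
  show "\<exists>us' y'. fuse f us y = fuse f us' y' \<and> reduces True (f us' y') (f us y)"
    using reduces_refl by blast
  fix a b assume "\<exists>us y. a = fuse f us y \<and> reduces True (f us y) b"
  then obtain us y where a: "a = fuse f us y" and "reduces True (f us y) b" by blast
  then obtain t where t: "t \<in> wrd True" "shd (f us y) = red_word t b"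
    "reduces True (stl (f us y)) (sdrop (length t) b)"
    using reduces_unfold[of True "f us y" b] by blast
  have "reduces True (f (us @ [shd (f us y)]) (stl (f us y))) (sdrop (length t) b)"
    using f t(3) by (rule reduces_trans)
  then show "\<exists>t\<in>wrd True. shd a = red_word t b \<and>
      (\<exists>us y. stl a = fuse f us y \<and> reduces True (f us y) (sdrop (length t) b))"
    using t(1,2) a by (intro bexI[of _ t]) auto
qed

lemma sdrop_fuse: "\<exists>y'. sdrop n (fuse f us y) = fuse f (us @ stake n (fuse f us y)) y'"
proof (induction n arbitrary: us y)
  case (Suc n)
  then show ?case using Suc[of "us @ [shd (f us y)]" "stl (f us y)"] by simp
qed auto

lemma red_word_shift: "length t \<le> length us \<Longrightarrow> red_word t (us @- y) = red_word t (us @- z)"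
proof (induction t arbitrary: us)
  case (Cons a t)
  then show ?case by (cases us) auto
qed simp

lemma red_list_shift:
  "length (concat ts) \<le> length us \<Longrightarrow> red_list ts (us @- y) = red_list ts (us @- z)"
proof (induction ts arbitrary: us)
  case (Cons t ts)
  then show ?case
    using red_word_shift[of t us y z] Cons.IH[of "drop (length t) us"] by (simp add: sdrop_shift)
qed simp

text \<open>Words are non-empty, so the total length bounds the number of terms. Each stage of a
  fusion thus meets finitely many requirements.\<close>

lemma finite_lists_wrd: "finite {ts \<in> lists (wrd b). length (concat ts) = n}"
proof -
  define A where "A = {t. set t \<subseteq> insert \<upsilon> \<Sigma> \<and> length t \<le> n}"
  have "finite A" unfolding A_def using finite_alphabet by (intro finite_lists_length_le) simp
  then have fin: "finite {ts. set ts \<subseteq> A \<and> length ts \<le> n}" by (rule finite_lists_length_le)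
  have "length ts \<le> length (concat ts) \<and> (\<forall>t\<in>set ts. length t \<le> length (concat ts))"
    if "ts \<in> lists (wrd b)" for ts
    using that
  proof (induction ts)
    case (Cons t ts)
    then have "1 \<le> length t" by (cases t) (auto simp: wrd_def)
    then show ?case using Cons by auto
  qed simp
  then have "{ts \<in> lists (wrd b). length (concat ts) = n} \<subseteq> {ts. set ts \<subseteq> A \<and> length ts \<le> n}"
    by (auto simp: A_def wrd_def)
  then show ?thesis using fin by (rule finite_subset)
qed

text \<open>Once the terms \<open>us\<close> are fixed, the remaining sequence is shrunk to satisfy
  \<open>Q\<close> for all finite reductions that use up exactly \<open>us\<close>.\<close>

lemma fusion:
  fixes Q :: "'a list list \<Rightarrow> 'a list stream \<Rightarrow> bool"
  assumes hered: "\<And>s y z. Q s y \<Longrightarrow> reduces True z y \<Longrightarrow> Q s z"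
    and dense: "\<And>s y. \<exists>z. reduces True z y \<and> Q s z"
  shows "\<exists>z. reduces True z y \<and>
    (\<forall>ts\<in>lists (wrd b). Q (red_list ts z) (sdrop (length (concat ts)) z))"
proof -
  \<comment> \<open>Here \<open>y\<close> merely pads \<open>us\<close> to a stream, as
    \<open>ts\<close> consumes exactly \<open>us\<close>.\<close>
  define S where "S us = (\<lambda>ts. red_list ts (us @- y)) `
    {ts \<in> lists (wrd b). length (concat ts) = length us}" for us
  define f where "f us y = (SOME z. reduces True z y \<and> (\<forall>s\<in>S us. Q s z))" for us y
  have f: "reduces True (f us y) y \<and> (\<forall>s\<in>S us. Q s (f us y))" for us y
  proof -
    have "finite (S us)" unfolding S_def by (intro finite_imageI finite_lists_wrd)
    then have "\<exists>z. reduces True z y \<and> (\<forall>s\<in>S us. Q s z)"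
      by (rule shrink_finite[of _ Q]) (fact hered, fact dense)
    then show ?thesis unfolding f_def by (rule someI_ex)
  qed
  define z where "z = fuse f [] y"
  have "reduces True z y"
    unfolding z_def using f by (intro reduces_trans[OF fuse_reduces[of f]]) auto
  moreover have "Q (red_list ts z) (sdrop (length (concat ts)) z)" if "ts \<in> lists (wrd b)" for ts
  proof -
    \<comment> \<open>After the \<open>n\<close> consumed terms, \<open>z\<close> continues as a
      fusion, which reduces a stream \<open>f (stake n z) y'\<close> for which \<open>Q\<close> was
      arranged.\<close>
    define n where "n = length (concat ts)"
    obtain y' where y': "sdrop n z = fuse f (stake n z) y'"
      using sdrop_fuse[of n f "[]" y] by (auto simp: z_def)
    have "red_list ts z = red_list ts (stake n z @- sdrop n z)" by (simp add: stake_sdrop)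
    also have "\<dots> = red_list ts (stake n z @- y)" by (rule red_list_shift) (simp add: n_def)
    also have "\<dots> \<in> S (stake n z)" using that by (auto simp: S_def n_def)
    finally have "Q (red_list ts z) (f (stake n z) y')" using f by blast
    then show ?thesis
      unfolding n_def[symmetric] y' by (rule hered) (use f in \<open>intro fuse_reduces, blast\<close>)
  qed
  ultimately show ?thesis by blast
qed

section \<open>Accepting and rejecting finite sequences\<close>

definition accepts where
  "accepts b F s y \<longleftrightarrow> (\<forall>x. reduces b x y \<longrightarrow> (\<exists>k. stake k (s @- x) \<in> F))"

text \<open>If rejection fails, some variable reduction accepts. Hence any \<open>s\<close> can be
  decided by one reduction, and both verdicts persist under further ones.\<close>

definition rejects where
  "rejects b F s y \<longleftrightarrow> (\<forall>z. reduces True z y \<longrightarrow> \<not> accepts b F s z)"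

lemma accepts_mono: "accepts b F s y \<Longrightarrow> reduces True z y \<Longrightarrow> accepts b F s z"
  unfolding accepts_def using reduces_trans by blast

lemma rejects_mono: "rejects b F s y \<Longrightarrow> reduces True z y \<Longrightarrow> rejects b F s z"
  unfolding rejects_def using reduces_trans by blast

lemma rejects_imp_not_accepts: "rejects b F s y \<Longrightarrow> \<not> accepts b F s y"
  unfolding rejects_def using reduces_refl by blast

lemma accepts_mem: "s \<in> F \<Longrightarrow> accepts b F s y"
  unfolding accepts_def by (intro allI impI exI[of _ "length s"]) (simp add: stake_shift)

lemma acceptsI:
  assumes "\<And>t. t \<in> wrd b \<Longrightarrow> accepts b F (s @ [red_word t y]) (sdrop (length t) y)"
  shows "accepts b F s y"
  unfolding accepts_def
proof (intro allI impI)
  fix x assume "reduces b x y"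
  then obtain t where t: "t \<in> wrd b" "shd x = red_word t y" "reduces b (stl x) (sdrop (length t) y)"
    using reduces_unfold[of b x y] by blast
  then obtain k where "stake k ((s @ [shd x]) @- stl x) \<in> F"
    using assms[OF t(1)] unfolding accepts_def by metis
  then show "\<exists>k. stake k (s @- x) \<in> F" by (intro exI[of _ k]) simp
qed

text \<open>After a fusion every one-term extension is decided, and the pigeonhole principle makes
  the verdict uniform. Were all extensions accepted, \<open>s\<close> would be accepted as
  well.\<close>

lemma rejects_extend:
  assumes "rejects b F s y"
  shows "\<exists>z. reduces True z y \<and> (\<forall>t\<in>wrd b. rejects b F (s @ [red_word t z]) (sdrop (length t) z))"
proof -
  let ?Q = "\<lambda>ts y. accepts b F (s @ ts) y \<or> rejects b F (s @ ts) y"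
  have "\<exists>z. reduces True z y \<and>
    (\<forall>ts\<in>lists (wrd b). ?Q (red_list ts z) (sdrop (length (concat ts)) z))"
  proof (rule fusion)
    show "?Q ts z" if "?Q ts y" "reduces True z y" for ts y z
      using that accepts_mono rejects_mono by blast
    show "\<exists>z. reduces True z y \<and> ?Q ts z" for ts y
      using reduces_refl unfolding rejects_def by blast
  qed
  then obtain z where z: "reduces True z y"
    "\<And>ts. ts \<in> lists (wrd b) \<Longrightarrow> ?Q (red_list ts z) (sdrop (length (concat ts)) z)" by blast
  have decided: "accepts b F (s @ [red_word t z]) (sdrop (length t) z) \<or>
      rejects b F (s @ [red_word t z]) (sdrop (length t) z)" if "t \<in> wrd b" for t
    using z(2)[of "[t]"] that by simp
  let ?P = "\<lambda>t. accepts b F (s @ [red_word t z]) (sdrop (length t) z)"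
  obtain \<tau> where \<tau>: "\<tau> \<in> streams (wrd True)"
    "(\<forall>t\<in>wrd b. ?P (red_word t \<tau>)) \<or> (\<forall>t\<in>wrd b. \<not> ?P (red_word t \<tau>))"
    using word_pigeonhole[of b ?P] by blast
  define z' where "z' = reduction z \<tau>"
  have z': "reduces True z' z" using \<tau>(1) by (auto simp: z'_def reduces_def)
  have word: "red_word t z' = red_word (red_word t \<tau>) z" for t
    by (simp add: z'_def red_word_reduction)
  \<comment> \<open>Verdicts reached for \<open>z\<close> thereby pass to the corresponding tails of
    \<open>z'\<close>.\<close>
  have tail: "reduces True (sdrop (length t) z') (sdrop (length (red_word t \<tau>)) z)" for t
    unfolding z'_def sdrop_reduction using sdrop_streams[OF \<tau>(1)] by (auto simp: reduces_def)
  have "reduces True z' y" using z' z(1) by (rule reduces_trans)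
  moreover have "rejects b F (s @ [red_word t z']) (sdrop (length t) z')" if t: "t \<in> wrd b" for t
  proof -
    have "\<not> (\<forall>t\<in>wrd b. ?P (red_word t \<tau>))"
    proof
      assume *: "\<forall>t\<in>wrd b. ?P (red_word t \<tau>)"
      have "accepts b F s z'"
      proof (rule acceptsI)
        fix t assume "t \<in> wrd b"
        with * have "?P (red_word t \<tau>)" by blast
        then show "accepts b F (s @ [red_word t z']) (sdrop (length t) z')"
          unfolding word using tail by (rule accepts_mono)
      qed
      then show False using assms \<open>reduces True z' y\<close> by (simp add: rejects_def)
    qed
    then have "\<not> ?P (red_word t \<tau>)" using \<tau>(2) t by blast
    then have "rejects b F (s @ [red_word (red_word t \<tau>) z]) (sdrop (length (red_word t \<tau>)) z)"
      using decided[of "red_word t \<tau>"] red_word_in_wrd[OF \<tau>(1) t] by blast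
    then show ?thesis unfolding word using tail by (rule rejects_mono)
  qed
  ultimately show ?thesis by blast
qed

lemma red_list_append:
  "red_list (ss @ ts) y = red_list ss y @ red_list ts (sdrop (length (concat ss)) y)"
  by (induction ss arbitrary: y) simp_all

text \<open>Fusion makes rejection hereditary to one-term extensions. If the empty sequence is not
  accepted, then all finite reductions are rejected, and members of \<open>F\<close> never
  are.\<close>

theorem galvin_dichotomy:
  "\<exists>z. reduces True z y \<and> ((\<forall>ts\<in>lists (wrd b). red_list ts z \<notin> F) \<or>
    (\<forall>x. reduces b x z \<longrightarrow> (\<exists>k. stake k x \<in> F)))"
proof -
  let ?Q = "\<lambda>s y. accepts b F s y \<or> rejects b F s y \<and>
    (\<forall>t\<in>wrd b. rejects b F (s @ [red_word t y]) (sdrop (length t) y))"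
  have "\<exists>z. reduces True z y \<and>
    (\<forall>ts\<in>lists (wrd b). ?Q (red_list ts z) (sdrop (length (concat ts)) z))"
  proof (rule fusion)
    fix s y z assume Q: "?Q s y" and z: "reduces True z y"
    have "rejects b F (s @ [red_word t z]) (sdrop (length t) z)"
      if "t \<in> wrd b" "\<forall>t\<in>wrd b. rejects b F (s @ [red_word t y]) (sdrop (length t) y)" for t
      using reduces_sdrop[OF z that(1)] that(2) rejects_mono by metis
    then show "?Q s z" using Q accepts_mono[OF _ z] rejects_mono[OF _ z] by blast
  next
    fix s y
    show "\<exists>z. reduces True z y \<and> ?Q s z"
    proof (cases "rejects b F s y")
      case True
      then show ?thesis using rejects_extend rejects_mono by blast
    next
      case False
      then show ?thesis unfolding rejects_def by blast
    qed
  qed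
  then obtain z where z: "reduces True z y"
    "\<And>ts. ts \<in> lists (wrd b) \<Longrightarrow> ?Q (red_list ts z) (sdrop (length (concat ts)) z)" by blast
  show ?thesis
  proof (cases "accepts b F [] z")
    case True
    then show ?thesis using z(1) by (auto simp: accepts_def)
  next
    case False
    have rej: "rejects b F (red_list ts z) (sdrop (length (concat ts)) z)" if "ts \<in> lists (wrd b)" for ts
      using that
    proof (induction ts rule: rev_induct)
      case Nil
      then show ?case using z(2)[of "[]"] False by simp
    next
      case (snoc t ts)
      then have "rejects b F (red_list ts z @ [red_word t (sdrop (length (concat ts)) z)])
          (sdrop (length t) (sdrop (length (concat ts)) z))"
        using z(2)[of ts] rejects_imp_not_accepts by auto
      then show ?case by (simp add: red_list_append)
    qed
    have "red_list ts z \<notin> F" if "ts \<in> lists (wrd b)" for ts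
      using rejects_imp_not_accepts[OF rej[OF that]] accepts_mem by blast
    then show ?thesis using z(1) by blast
  qed
qed

lemma stake_reduction: "stake (length ts) (reduction y (ts @- \<tau>)) = red_list ts y"
  by (induction ts arbitrary: y) simp_all

theorem thin_monochromatic:
  assumes thin: "\<And>s t. s \<in> F \<Longrightarrow> s @ t \<in> F \<Longrightarrow> t = []" and "finite (\<chi> ` F)"
  shows "\<exists>z. reduces True z y \<and> (\<exists>c. \<forall>ts\<in>lists (wrd b). red_list ts z \<in> F \<longrightarrow> \<chi> (red_list ts z) = c)"
proof -
  let ?Q = "\<lambda>c z. (\<forall>ts\<in>lists (wrd b). red_list ts z \<notin> {s \<in> F. \<chi> s = c}) \<or>
    (\<forall>x. reduces b x z \<longrightarrow> (\<exists>k. stake k x \<in> {s \<in> F. \<chi> s = c}))"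
  have "\<exists>z. reduces True z y \<and> (\<forall>c\<in>\<chi> ` F. ?Q c z)"
  proof (rule shrink_finite[OF assms(2)])
    show "\<exists>z. reduces True z y \<and> ?Q c z" for c y by (rule galvin_dichotomy)
    fix c y z assume Q: "?Q c y" and z: "reduces True z y"
    obtain \<tau> where \<tau>: "\<tau> \<in> streams (wrd True)" "z = reduction y \<tau>" using z by (auto simp: reduces_def)
    from Q show "?Q c z"
    proof
      assume *: "\<forall>ts\<in>lists (wrd b). red_list ts y \<notin> {s \<in> F. \<chi> s = c}"
      have "red_list ts z \<notin> {s \<in> F. \<chi> s = c}" if "ts \<in> lists (wrd b)" for ts
        using * red_list_in_wrd[OF \<tau>(1) that] unfolding \<tau>(2) red_list_reduction by blast
      then show ?thesis by blast
    qed (use reduces_trans[OF _ z] in blast)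
  qed
  then obtain z where z: "reduces True z y" "\<And>c. c \<in> \<chi> ` F \<Longrightarrow> ?Q c z" by blast
  show ?thesis
  proof (cases "\<exists>ts\<in>lists (wrd b). red_list ts z \<in> F")
    case False
    then show ?thesis using z(1) by blast
  next
    case True
    then obtain us where us: "us \<in> lists (wrd b)" "red_list us z \<in> F" by blast
    define c where "c = \<chi> (red_list us z)"
    \<comment> \<open>The reduction \<open>us\<close> has colour \<open>c\<close> and so refutes the
      first alternative for \<open>c\<close>.\<close>
    have front: "\<exists>k. stake k x \<in> F \<and> \<chi> (stake k x) = c" if "reduces b x z" for x
      using z(2)[of c] us that by (auto simp: c_def)
    have "\<chi> (red_list ts z) = c" if ts: "ts \<in> lists (wrd b)" "red_list ts z \<in> F" for ts
    proof -
      obtain t where t: "t \<in> wrd b" using wrd_nonempty by blast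
      \<comment> \<open>Any infinite reduction that begins with the given finite one will do;
        thinness identifies its initial segment of colour \<open>c\<close> with that finite
        one.\<close>
      define x where "x = reduction z (ts @- sconst t)"
      have "reduces b x z"
        using ts(1) t by (auto simp: x_def reduces_def intro: shift_streams sconst_streams)
      then obtain k where k: "stake k x \<in> F" "\<chi> (stake k x) = c" using front by blast
      have "stake (length ts) x \<in> F" using ts(2) by (simp add: x_def stake_reduction)
      moreover have "stake (length ts) x = stake k x"
      proof (cases "k \<le> length ts")
        case True
        then obtain n where n: "length ts = k + n" using le_Suc_ex by blast
        have "stake k x @ stake n (sdrop k x) \<in> F" using calculation n by simp
        then have "stake n (sdrop k x) = []" by (rule thin[OF k(1)])
        then show ?thesis using n by simp
      next
        case False
        then obtain n where n: "k = length ts + n" using le_Suc_ex nat_le_linear by blast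
        have "stake (length ts) x @ stake n (sdrop (length ts) x) \<in> F" using k(1) n by simp
        then have "stake n (sdrop (length ts) x) = []" by (rule thin[OF calculation])
        then show ?thesis using n by simp
      qed
      ultimately show ?thesis using k(2) by (simp add: x_def stake_reduction)
    qed
    then show ?thesis using z(1) by blast
  qed
qed

end


section \<open>Thinness of the Schreier families\<close>

definition comparable :: "nat set \<Rightarrow> nat set \<Rightarrow> bool" where
  "comparable s t \<longleftrightarrow> (\<exists>n. s = t \<inter> {..<n} \<or> t = s \<inter> {..<n})"

lemma comparable_sym: "comparable s t \<Longrightarrow> comparable t s"
  unfolding comparable_def by blast

lemma initial_part:
  assumes "finite a" "set_less a b"
  shows "\<exists>n. a = (a \<union> b) \<inter> {..<n}"
proof (cases "a = {}")
  case True
  then show ?thesis by (intro exI[of _ 0]) simp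
next
  case False
  then have "x < Suc (Max a)" if "x \<in> a" for x using assms(1) that by (simp add: less_Suc_eq_le)
  moreover have "\<not> x < Suc (Max a)" if "x \<in> b" for x
    using assms that False by (auto simp: set_less_def not_less Suc_le_eq)
  ultimately show ?thesis by (intro exI[of _ "Suc (Max a)"]) blast
qed

text \<open>Both \<open>a\<close> and \<open>c\<close> are initial segments of the larger union, and
  initial segments of one set are comparable.\<close>

lemma comparable_Un_left:
  assumes "comparable (a \<union> b) (c \<union> d)" "finite a" "finite c" "set_less a b" "set_less c d"
  shows "comparable a c"
proof -
  have *: "comparable a c"
    if eq: "a \<union> b = (c \<union> d) \<inter> {..<n}" and a: "finite a" "set_less a b" and c: "finite c" "set_less c d"
    for a b c d :: "nat set" and n
  proof -
    obtain m where m: "a = (a \<union> b) \<inter> {..<m}" using initial_part[OF a] by blast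
    obtain k where k: "c = (c \<union> d) \<inter> {..<k}" using initial_part[OF c] by blast
    have a_eq: "a = (c \<union> d) \<inter> {..<min m n}" using m unfolding eq by auto
    show ?thesis
    proof (cases "min m n \<le> k")
      case True
      then have "(c \<union> d) \<inter> {..<min m n} = (c \<union> d) \<inter> {..<k} \<inter> {..<min m n}" by auto
      then have "a = c \<inter> {..<min m n}" unfolding k[symmetric] a_eq[symmetric] .
      then show ?thesis unfolding comparable_def by blast
    next
      case False
      then have "(c \<union> d) \<inter> {..<k} = (c \<union> d) \<inter> {..<min m n} \<inter> {..<k}" by auto
      then have "c = a \<inter> {..<k}" unfolding k[symmetric] a_eq[symmetric] .
      then show ?thesis unfolding comparable_def by blast
    qed
  qed
  from assms(1) obtain n where "a \<union> b = (c \<union> d) \<inter> {..<n} \<or> c \<union> d = (a \<union> b) \<inter> {..<n}"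
    unfolding comparable_def by blast
  then show ?thesis
  proof
    assume "a \<union> b = (c \<union> d) \<inter> {..<n}"
    from *[OF this assms(2,4,3,5)] show ?thesis .
  next
    assume "c \<union> d = (a \<union> b) \<inter> {..<n}"
    from *[OF this assms(3,5,2,4)] show ?thesis by (rule comparable_sym)
  qed
qed

lemma comparable_Un_right:
  assumes "comparable (a \<union> b) (a \<union> d)" "set_less a b" "set_less a d"
  shows "comparable b d"
proof -
  have "a \<inter> b = {}" "a \<inter> d = {}" using assms(2,3) by (auto simp: set_less_def)
  then have b: "b = (a \<union> b) - a" and d: "d = (a \<union> d) - a" by blast+
  from assms(1) obtain n where "a \<union> b = (a \<union> d) \<inter> {..<n} \<or> a \<union> d = (a \<union> b) \<inter> {..<n}"
    unfolding comparable_def by blast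
  then have "b = d \<inter> {..<n} \<or> d = b \<inter> {..<n}" using b d by blast
  then show ?thesis unfolding comparable_def by blast
qed

lemma comparable_Min:
  assumes "comparable s t" "finite s" "finite t" "s \<noteq> {}" "t \<noteq> {}"
  shows "Min s = Min t"
proof -
  have *: "Min s = Min t" if s: "s = t \<inter> {..<n}" "s \<noteq> {}" "finite t" for s t :: "nat set" and n
  proof (rule antisym)
    have "Min s \<in> s" using s by (intro Min_in) auto
    then show le: "Min t \<le> Min s" using s by simp
    have "Min t \<in> t" using s by (intro Min_in) auto
    moreover have "Min t < n" using le \<open>Min s \<in> s\<close> s(1) by auto
    ultimately have "Min t \<in> s" using s(1) by simp
    then show "Min s \<le> Min t" using s by (intro Min_le) auto
  qed
  show ?thesis using assms *[of s t] *[of t s] unfolding comparable_def by metis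
qed

lemma set_less_Union: "(\<And>t. t \<in> S \<Longrightarrow> set_less s t) \<Longrightarrow> set_less s (\<Union>S)"
  by (auto simp: set_less_def)

text \<open>Blocks are peeled off from the left: first blocks are comparable, hence equal, and can
  be cancelled.\<close>

lemma comparable_concat_eq:
  assumes "list_all2 (\<lambda>s t. finite s \<and> finite t \<and> (comparable s t \<longrightarrow> s = t)) ss ts"
    and "sorted_wrt set_less ss" "sorted_wrt set_less ts"
    and "comparable (\<Union>(set ss)) (\<Union>(set ts))"
  shows "ss = ts"
  using assms
proof (induction ss ts rule: list_all2_induct)
  case (Cons s ss t ts)
  have less: "set_less s (\<Union>(set ss))" "set_less t (\<Union>(set ts))"
    using Cons.prems by (auto intro: set_less_Union)
  have "comparable (s \<union> \<Union>(set ss)) (t \<union> \<Union>(set ts))" using Cons.prems by simp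
  moreover from this have st: "s = t"
    using comparable_Un_left[OF _ _ _ less] Cons.hyps(1) by blast
  ultimately have "comparable (\<Union>(set ss)) (\<Union>(set ts))"
    using comparable_Un_right[of s "\<Union>(set ss)" "\<Union>(set ts)"] less by simp
  then have "ss = ts" using Cons.IH Cons.prems by simp
  with st show ?case by simp
qed simp

lemma schreier_finite: "schreier L \<xi> s \<Longrightarrow> finite s"
proof (induction rule: schreier.induct)
  case (cnf \<xi> \<alpha> p xs ss)
  have "finite (ss ! i)" if "i < length ss" for i
  proof -
    from cnf.IH that obtain ts where "\<forall>t\<in>set ts. finite t" "ss ! i = \<Union>(set ts)" by blast
    then show ?thesis by simp
  qed
  then have "\<forall>s\<in>set ss. finite s" by (metis in_set_conv_nth)
  then show ?case by simp
qed auto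

text \<open>The clause equations decompose \<open>t\<close> by the clause that produced
  \<open>s\<close>, and the parts are compared in increasing order.\<close>

theorem schreier_thin:
  "schreier L \<xi> s \<Longrightarrow> schreier L \<xi> t \<Longrightarrow> comparable s t \<Longrightarrow> s = t"
proof (induction arbitrary: t rule: schreier.induct)
  case zero
  then show ?case by (simp add: schreier_0_iff)
next
  case (one n)
  then obtain m where "t = {m}" using schreier_1_iff by blast
  then show ?case using comparable_Min[of "{n}" "{m}"] one.prems(2) by simp
next
  case (succ n s \<zeta>)
  obtain m t' where t: "t = {m} \<union> t'" "set_less {m} t'" "schreier L \<zeta> t'"
    using succ.prems(1) unfolding schreier_succ_iff by (elim exE conjE)
  have "comparable {n} {m}"
    using succ.prems(2) succ.hyps t by (intro comparable_Un_left[of "{n}" s "{m}" t']) auto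
  then have "n = m" using comparable_Min[of "{n}" "{m}"] by simp
  then have "comparable s t'"
    using comparable_Un_right[of "{n}" s t'] succ.prems(2) succ.hyps t(1,2) by simp
  then show ?case using succ.IH t \<open>n = m\<close> by blast
next
  case (pow_succ ss \<beta>)
  obtain ts where ts: "t = \<Union>(set ts)" "ts \<noteq> []" "length ts = Min (hd ts)" "sorted_wrt set_less ts"
    "\<forall>s\<in>set ts. schreier L (omega_pow \<beta>) s"
    using pow_succ.prems(1) unfolding schreier_pow_succ_iff by (elim exE conjE)
  have thin: "finite s \<and> finite u \<and> (comparable s u \<longrightarrow> s = u)" if "s \<in> set ss" "u \<in> set ts" for s u
    using bspec[OF pow_succ.IH that(1)] bspec[OF ts(5) that(2)]
      schreier_finite[of L "omega_pow \<beta>" s] schreier_finite[of L "omega_pow \<beta>" u] by simp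
  obtain s0 ss' where ss': "ss = s0 # ss'" using pow_succ.hyps(1) by (cases ss) auto
  obtain t0 ts' where ts': "ts = t0 # ts'" using ts(2) by (cases ts) auto
  have less: "set_less s0 (\<Union>(set ss'))" "set_less t0 (\<Union>(set ts'))"
    using pow_succ.hyps ts(4) ss' ts' by (auto intro: set_less_Union)
  have fin: "finite s0 \<and> finite t0 \<and> (comparable s0 t0 \<longrightarrow> s0 = t0)"
    using ss' ts' by (intro thin) simp_all
  have "comparable (s0 \<union> \<Union>(set ss')) (t0 \<union> \<Union>(set ts'))"
    using pow_succ.prems(2) ts(1) ss' ts' by simp
  from comparable_Un_left[OF this _ _ less] have "comparable s0 t0" using fin by blast
  then have "s0 = t0" using fin by simp
  \<comment> \<open>The number of blocks is the minimum of the first block, which is common to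
    both.\<close>
  then have "length ss = length ts" using pow_succ.hyps ts(3) ss' ts' by simp
  then have "list_all2 (\<lambda>s t. finite s \<and> finite t \<and> (comparable s t \<longrightarrow> s = t)) ss ts"
    by (intro list_all2_all_nthI thin) simp_all
  then have "ss = ts"
    using pow_succ.hyps(3) ts(4) pow_succ.prems(2)[unfolded ts(1)] by (rule comparable_concat_eq)
  then show ?case using ts(1) by simp
next
  case (pow_limit l s)
  have t: "t \<noteq> {}" "schreier L (omega_pow (L l (Min t))) t"
    using pow_limit.prems(1) unfolding schreier_pow_limit_iff[OF pow_limit.hyps(1)] by simp_all
  have "finite s" "finite t" using pow_limit.hyps(3) t(2) schreier_finite by blast+
  \<comment> \<open>Equal minima select the same term of the fundamental sequence, so the induction
    hypothesis applies to \<open>t\<close>.\<close>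
  then have "Min s = Min t" using pow_limit.prems(2) pow_limit.hyps(2) t(1) by (intro comparable_Min)
  then show ?case using pow_limit.IH pow_limit.prems(2) t(2) by simp
next
  case (cnf \<xi> \<alpha> p xs ss)
  let ?xs = "(\<alpha>, p) # xs"
  obtain ts where ts: "t = \<Union>(set ts)" "length ts = length ?xs" "sorted_wrt (\<lambda>s t. set_less t s) ts"
    "\<forall>i<length ts. \<exists>us. length us = snd (?xs ! i) \<and> sorted_wrt set_less us \<and>
       (\<forall>t\<in>set us. schreier L (omega_pow (fst (?xs ! i))) t) \<and> ts ! i = \<Union>(set us)"
    using cnf.prems(1) unfolding schreier_cnf_iff[OF cnf.hyps(3,4,1,2,5,6)] by (elim exE conjE)
  have len: "length ss = length ts" using cnf.hyps ts(2) by simp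
  \<comment> \<open>The inner level: the blocks that belong to one exponent.\<close>
  have thin: "finite (ss ! i) \<and> finite (ts ! i) \<and> (comparable (ss ! i) (ts ! i) \<longrightarrow> ss ! i = ts ! i)"
    if i: "i < length ss" for i
  proof -
    from cnf.IH[rule_format, OF i] obtain vs where vs: "length vs = snd (?xs ! i)" "sorted_wrt set_less vs"
      "\<forall>v\<in>set vs. schreier L (omega_pow (fst (?xs ! i))) v \<and>
         (\<forall>u. schreier L (omega_pow (fst (?xs ! i))) u \<longrightarrow> comparable v u \<longrightarrow> v = u)"
      "ss ! i = \<Union>(set vs)"
      by (elim exE conjE)
    from ts(4)[rule_format, OF i[unfolded len]] obtain us where us: "length us = snd (?xs ! i)" "sorted_wrt set_less us"
      "\<forall>u\<in>set us. schreier L (omega_pow (fst (?xs ! i))) u" "ts ! i = \<Union>(set us)"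
      by (elim exE conjE)
    have fin: "\<forall>v\<in>set vs. finite v" "\<forall>u\<in>set us. finite u"
      by (intro ballI, drule bspec[OF vs(3)], elim conjE, erule schreier_finite)
        (intro ballI, drule bspec[OF us(3)], erule schreier_finite)
    have "list_all2 (\<lambda>s t. finite s \<and> finite t \<and> (comparable s t \<longrightarrow> s = t)) vs us"
    proof (rule list_all2_all_nthI)
      fix j assume "j < length vs"
      then have "vs ! j \<in> set vs" "us ! j \<in> set us" using vs(1) us(1) by simp_all
      then show "finite (vs ! j) \<and> finite (us ! j) \<and> (comparable (vs ! j) (us ! j) \<longrightarrow> vs ! j = us ! j)"
        using bspec[OF vs(3), of "vs ! j"] bspec[OF us(3), of "us ! j"] fin by simp
    qed (simp add: vs(1) us(1))
    from comparable_concat_eq[OF this vs(2) us(2)] have "vs = us" if "comparable (ss ! i) (ts ! i)"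
      using that vs(4) us(4) by simp
    then show ?thesis using fin vs(4) us(4) by auto
  qed
  have "list_all2 (\<lambda>s t. finite s \<and> finite t \<and> (comparable s t \<longrightarrow> s = t)) ss ts"
    using thin len by (intro list_all2_all_nthI) simp_all
  \<comment> \<open>The Cantor normal form lists the leftmost set last.\<close>
  then have "list_all2 (\<lambda>s t. finite s \<and> finite t \<and> (comparable s t \<longrightarrow> s = t)) (rev ss) (rev ts)"
    by simp
  moreover have "sorted_wrt set_less (rev ss)" "sorted_wrt set_less (rev ts)"
    using cnf.hyps(8) ts(3) by (simp_all add: sorted_wrt_rev)
  moreover have "comparable (\<Union>(set (rev ss))) (\<Union>(set (rev ts)))"
    using cnf.prems(2) ts(1) by simp
  ultimately have "rev ss = rev ts" by (rule comparable_concat_eq)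
  then show ?case using ts(1) by simp
qed

text \<open>The cut is the position at which the first word of \<open>vs\<close> starts. Non-empty
  words make starting positions strictly increasing.\<close>

lemma dset_append:
  assumes "[] \<notin> set ws" "ws \<noteq> []"
  shows "dset ws = dset (ws @ vs) \<inter> {..<1 + (\<Sum>j<length ws. length (ws ! j))}"
    and "vs \<noteq> [] \<Longrightarrow> 1 + (\<Sum>j<length ws. length (ws ! j)) \<in> dset (ws @ vs)"
proof -
  let ?p = "\<lambda>i. 1 + (\<Sum>j<i. length ((ws @ vs) ! j))"
  have p: "1 + (\<Sum>j<i. length (ws ! j)) = ?p i" if "i \<le> length ws" for i
    using that by (simp add: nth_append)
  have mono: "?p i \<le> ?p k" if "i \<le> k" for i k
    using that by (auto intro!: sum_mono2)
  have strict: "?p i < ?p (length ws)" if "i < length ws" for i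
  proof -
    have "ws ! i \<noteq> []" using nth_mem[OF that] assms(1) by metis
    then have "?p i < ?p (Suc i)" using that by (simp add: nth_append)
    also have "\<dots> \<le> ?p (length ws)" using that by (intro mono) simp
    finally show ?thesis .
  qed
  have ws: "dset ws = ?p ` {1..<length ws}" unfolding dset_def using p by (intro image_cong) auto
  have app: "dset (ws @ vs) = ?p ` {1..<length ws + length vs}" unfolding dset_def by simp
  show "dset ws = dset (ws @ vs) \<inter> {..<1 + (\<Sum>j<length ws. length (ws ! j))}"
    unfolding ws app p[OF order.refl]
  proof (intro equalityI subsetI)
    fix x assume "x \<in> ?p ` {1..<length ws + length vs} \<inter> {..<?p (length ws)}"
    then obtain i where i: "x = ?p i" "1 \<le> i" "?p i < ?p (length ws)" by auto
    then have "i < length ws" using mono[of "length ws" i] by linarith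
    then show "x \<in> ?p ` {1..<length ws}" using i by auto
  qed (use strict in auto)
  show "1 + (\<Sum>j<length ws. length (ws ! j)) \<in> dset (ws @ vs)" if "vs \<noteq> []"
    unfolding app p[OF order.refl] using that assms(2) by (intro imageI) (simp add: Suc_le_eq)
qed

theorem schreier_seqs_thin:
  assumes "[] \<notin> X" "ws \<in> schreier_seqs L \<xi> X" "ws @ vs \<in> schreier_seqs L \<xi> X"
  shows "vs = []"
proof (cases "\<xi> = 0")
  case True
  then show ?thesis using assms(2,3) by (auto simp: schreier_seqs_def)
next
  case False
  then have ws: "[] \<notin> set ws" "ws \<noteq> []" "schreier L \<xi> (dset ws)" "schreier L \<xi> (dset (ws @ vs))"
    using assms by (auto simp: schreier_seqs_def schreier_family_def)
  \<comment> \<open>A non-empty \<open>vs\<close> would add its starting position to the right-hand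
    side.\<close>
  have "dset ws = dset (ws @ vs)"
    using schreier_thin[OF ws(3,4)] dset_append(1)[OF ws(1,2)] unfolding comparable_def by blast
  then show ?thesis using dset_append[OF ws(1,2), of vs] by auto
qed


section \<open>The partition theorem\<close>

context alphabet
begin

lemma reduce_block_snth: "reduce_block \<upsilon> (snth y) k t = red_word t (sdrop k y)"
proof (induction t arbitrary: k)
  case Nil
  show ?case by (simp add: reduce_block_def)
next
  case (Cons a t)
  have "reduce_block \<upsilon> (snth y) k (a # t) = subst_word \<upsilon> (y !! k) a @ reduce_block \<upsilon> (snth y) (Suc k) t"
    by (simp add: reduce_block_def upt_conv_Cons map_Suc_upt[symmetric] comp_def del: upt_Suc)
  then show ?case using Cons by simp
qed

text \<open>The offset \<open>k\<close> is there for the induction: the remaining words start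
  \<open>length t\<close> positions later.\<close>

lemma map_reduce_block_snth:
  "map (\<lambda>i. reduce_block \<upsilon> (snth y) (k + (\<Sum>j<i. length (ts ! j))) (ts ! i)) [0..<length ts] =
    red_list ts (sdrop k y)"
proof (induction ts arbitrary: k)
  case (Cons t ts)
  from Cons[of "k + length t"] show ?case
    by (simp add: upt_conv_Cons map_Suc_upt[symmetric] comp_def sum.lessThan_Suc_shift
        reduce_block_snth add.assoc del: upt_Suc sum.lessThan_Suc)
qed simp

lemma reduce_fin_snth: "reduce_fin \<upsilon> (snth y) ts = red_list ts y"
  using map_reduce_block_snth[of y 0 ts] by (simp add: reduce_fin_def)

lemma snth_reduction:
  "reduction (sdrop k y) \<tau> !! i = reduce_block \<upsilon> (snth y) (k + (\<Sum>j<i. length (\<tau> !! j))) (\<tau> !! i)"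
proof (induction i arbitrary: k \<tau>)
  case (Suc i)
  from Suc[of "k + length (shd \<tau>)" "stl \<tau>"] show ?case
    by (simp add: sum.lessThan_Suc_shift add.assoc del: sum.lessThan_Suc)
qed (simp add: reduce_block_snth)

lemma var_reduction_snth:
  assumes "reduces True x y"
  shows "var_reduction \<Sigma> \<upsilon> (snth x) (snth y)"
proof -
  obtain \<tau> where \<tau>: "\<tau> \<in> streams (wrd True)" "x = reduction y \<tau>"
    using assms by (auto simp: reduces_def)
  have "snth x = reduce_inf \<upsilon> (snth y) (snth \<tau>)"
    using snth_reduction[of 0 y \<tau>] by (simp add: fun_eq_iff reduce_inf_def \<tau>(2))
  then show ?thesis
    using \<tau>(1) unfolding var_reduction_def var_words_eq_wrd streams_iff_snth by blast
qed

lemma schreier_seqs_monochromatic: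
  assumes "[] \<notin> X" "\<chi> \<in> schreier_seqs L \<xi> X \<rightarrow> {1..r :: nat}"
  shows "\<exists>z. reduces True z y \<and>
    (\<exists>c. \<forall>s \<in> schreier_seqs L \<xi> X \<inter> reduce_fin \<upsilon> (snth z) ` lists (wrd b). \<chi> s = c)"
proof -
  have "finite (\<chi> ` schreier_seqs L \<xi> X)"
    using assms(2) by (intro finite_subset[OF _ finite_atLeastAtMost[of 1 r]]) auto
  then obtain z c where "reduces True z y"
    "\<forall>ts\<in>lists (wrd b). red_list ts z \<in> schreier_seqs L \<xi> X \<longrightarrow> \<chi> (red_list ts z) = c"
    using thin_monochromatic[of "schreier_seqs L \<xi> X" \<chi> y b] schreier_seqs_thin[OF assms(1)] by blast
  then show ?thesis unfolding reduce_fin_snth by blast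
qed

lemma reduce_fin_image_mono:
  assumes "reduces True x y"
  shows "reduce_fin \<upsilon> (snth x) ` lists (wrd b) \<subseteq> reduce_fin \<upsilon> (snth y) ` lists (wrd b)"
proof -
  obtain \<tau> where \<tau>: "\<tau> \<in> streams (wrd True)" "x = reduction y \<tau>"
    using assms by (auto simp: reduces_def)
  show ?thesis
    unfolding reduce_fin_snth \<tau>(2) red_list_reduction using red_list_in_wrd[OF \<tau>(1)] by blast
qed

end

theorem theoremA:
  fixes \<Sigma> :: "'a set" and \<upsilon> :: 'a
    and L :: "omega1 \<Rightarrow> nat \<Rightarrow> omega1" and \<xi> :: omega1
    and \<chi>\<^sub>1 \<chi>\<^sub>2 :: "'a list list \<Rightarrow> nat" and r\<^sub>1 r\<^sub>2 :: nat
    and w :: "nat \<Rightarrow> 'a list"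
  assumes "finite \<Sigma>" and "\<Sigma> \<noteq> {}" and "\<upsilon> \<notin> \<Sigma>"
    and "fundamental_seqs L"
    and "1 \<le> r\<^sub>1" and "\<chi>\<^sub>1 \<in> schreier_seqs L \<xi> (words \<Sigma>) \<rightarrow> {1..r\<^sub>1}"
    and "1 \<le> r\<^sub>2" and "\<chi>\<^sub>2 \<in> schreier_seqs L \<xi> (var_words \<Sigma> \<upsilon>) \<rightarrow> {1..r\<^sub>2}"
    and "\<And>n. w n \<in> var_words \<Sigma> \<upsilon>"
  shows "\<exists>u. var_reduction \<Sigma> \<upsilon> u w \<and>
    (\<exists>c. \<forall>s \<in> schreier_seqs L \<xi> (words \<Sigma>) \<inter> RW \<Sigma> \<upsilon> u. \<chi>\<^sub>1 s = c) \<and>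
    (\<exists>c. \<forall>s \<in> schreier_seqs L \<xi> (var_words \<Sigma> \<upsilon>) \<inter> VRW \<Sigma> \<upsilon> u. \<chi>\<^sub>2 s = c)"
proof -
  interpret alphabet \<Sigma> \<upsilon>
    using assms(1-3) by unfold_locales
  define y where "y = smap w (fromN 0)"
  have w: "w = snth y" by (simp add: y_def fun_eq_iff)
  have "[] \<notin> words \<Sigma>" "[] \<notin> var_words \<Sigma> \<upsilon>" by (auto simp: words_def var_words_def)
  then obtain z c\<^sub>1 where z: "reduces True z y"
    "\<forall>s \<in> schreier_seqs L \<xi> (words \<Sigma>) \<inter> reduce_fin \<upsilon> (snth z) ` lists (wrd False). \<chi>\<^sub>1 s = c\<^sub>1"
    using schreier_seqs_monochromatic[OF _ assms(6)] by blast
  \<comment> \<open>The second colouring is treated inside \<open>z\<close>; finite reductions of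
    \<open>x\<close> are finite reductions of \<open>z\<close>, so \<open>\<chi>\<^sub>1\<close>
    stays constant.\<close>
  obtain x c\<^sub>2 where x: "reduces True x z"
    "\<forall>s \<in> schreier_seqs L \<xi> (var_words \<Sigma> \<upsilon>) \<inter> reduce_fin \<upsilon> (snth x) ` lists (wrd True). \<chi>\<^sub>2 s = c\<^sub>2"
    using schreier_seqs_monochromatic[OF \<open>[] \<notin> var_words \<Sigma> \<upsilon>\<close> assms(8)] by blast
  have "var_reduction \<Sigma> \<upsilon> (snth x) w"
    unfolding w using reduces_trans[OF x(1) z(1)] by (rule var_reduction_snth)
  moreover have "\<forall>s \<in> schreier_seqs L \<xi> (words \<Sigma>) \<inter> RW \<Sigma> \<upsilon> (snth x). \<chi>\<^sub>1 s = c\<^sub>1"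
    using z(2) reduce_fin_image_mono[OF x(1), of False] unfolding RW_def words_eq_wrd by blast
  moreover have "\<forall>s \<in> schreier_seqs L \<xi> (var_words \<Sigma> \<upsilon>) \<inter> VRW \<Sigma> \<upsilon> (snth x). \<chi>\<^sub>2 s = c\<^sub>2"
    using x(2) unfolding VRW_def var_words_eq_wrd by blast
  ultimately show ?thesis by blast
qed

end
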